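(* Let $X\in\mathbb{R}^{n\times K}$ be a snapshot matrix with largest singular value $\sigma_1$, and let $V_r,\Sigma_r,W_r$ be the factors of its exact rank-$r$ truncated SVD. Let $\tilde V_r,\tilde\Sigma_r,\tilde W_r$ be approximate rank-$r$ SVD factors from a streaming SVD giving the approximation $\tilde X$ of $X$, with right singular vector error $\tau_w=\|W_r-\tilde W_r\|_F$. Assume the time-derivative data are computed via finite differences, $\dot X=X\Delta_K$. Suppose $\|X-\tilde X\|_2\le\varepsilon$, and that $\Gamma=\mathrm{diag}(\gamma_1,\dots,\gamma_d)$ with $\gamma_j>0$ for all $j$, and let $\sqrt{\gamma_{\min}}=\min_j\sqrt{\gamma_j}$. Let $\bar D,\bar R$ (exact) and $\tilde D,\tilde R$ (streaming) be the data matrices of the reformulation paradigms (iSVD-LS/RLS), with data matrix perturbations $E_D$ and $E_R$, as defined in the context. Then $$\|E_D\|_2\le\frac{\sigma_1\beta_2}{\sqrt r\,(\sigma_1+\varepsilon)}\,\tau_w+\frac{\beta_2}{\sigma_1+\varepsilon}\,\varepsilon,\qquad \|E_R\|_F\le\sigma_1\|\Delta_K\|_2\,\tau_w+\sqrt r\,\|\Delta_K\|_2\,\varepsilon,$$ and the operator error between the batch solution $O=\bar D^\dagger\bar R$ and the streaming solution $\tilde O=\tilde D^\dagger\tilde R$ satisfies $$\|O-\tilde O\|_F\le\frac{\sigma_1\|\Delta_K\|_2}{\sqrt{\gamma_{\min}}}\,\tau_w\Bigl(1+\frac{\alpha\beta_2}{\sqrt{\gamma_{\min}}}\Bigr)+\frac{(\alpha\beta_2+\sqrt{\gamma_{\min}})\sqrt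 r\,\|\Delta_K\|_2}{\gamma_{\min}}\,\varepsilon,$$ where $\beta_2=\sqrt r\,(\sigma_1+\varepsilon)\sqrt{1+(2\sigma_1+\varepsilon)^2}$, and $\alpha=\sqrt2$ if $K\ne d$, $\alpha=1$ if $K=d$.
   Context: Notation: $\|\cdot\|_2$ is the spectral norm, $\|\cdot\|_F$ the Frobenius norm, $^\dagger$ the Moore–Penrose pseudoinverse, $\otimes$ the Kronecker product, and for $A=[a_1,\dots,a_K]$, $A\odot A=[a_1\otimes a_1,\dots,a_K\otimes a_K]$ is the Khatri–Rao (column-wise Kronecker) product. All matrices are real; $\mathbf 1_K\in\mathbb{R}^K$ is the all-ones vector. Setting: $n,K,m$ are positive integers, $1\le r\le\min\{n,K\}$, $d=r+r^2+m+1$. $X\in\mathbb{R}^{n\times K}$ is the (nonzero) snapshot matrix, $U\in\mathbb{R}^{m\times K}$ the input matrix, $\Delta_K\in\mathbb{R}^{K\times K}$ a finite difference matrix and $\dot X=X\Delta_K$ the time-derivative data. Exact SVD: $X=V\Sigma W^\top$ with singular values $\sigma_1\ge\sigma_2\ge\dots\ge0$. $V_r\in\mathbb{R}^{n\times r}$ and $W_r\in\mathbb{R}^{K\times r}$ consist of the first $r$ left and right singular vectors (orthonormal columns), and $\Sigma_r=\mathrm{diag}(\sigma_1,\dots,\sigma_r)$. Streaming (approximate) SVD: $\tilde X=\tilde V\tilde\Sigma\tilde W^\top$ is an SVD (orthonormal columns in $\tilde V,\tilde W$; $\tilde\Sigma$ diagonal with nonnegative nonincreasing entries $\tilde\sigma_j$)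 approximating $X$, and $\tilde V_r\in\mathbb{R}^{n\times r}$, $\tilde\Sigma_r=\mathrm{diag}(\tilde\sigma_1,\dots,\tilde\sigma_r)$, $\tilde W_r\in\mathbb{R}^{K\times r}$ are its leading rank-$r$ factors. Data matrices of the reformulation paradigms (the reduced data $V_r^\top X$ are expressed through the SVD factors as $\Sigma_rW_r^\top$): $$D=[(\Sigma_rW_r^\top)^\top,\ (\Sigma_rW_r^\top\odot\Sigma_rW_r^\top)^\top,\ U^\top,\ \mathbf 1_K]\in\mathbb{R}^{K\times d},\qquad R=(\Sigma_rW_r^\top\Delta_K)^\top=\Delta_K^\top W_r\Sigma_r\in\mathbb{R}^{K\times r},$$ $$\bar D=\begin{bmatrix}D\\ \Gamma^{1/2}\end{bmatrix},\qquad \bar R=\begin{bmatrix}R\\ 0_{d\times r}\end{bmatrix}.$$ The streaming matrices $\tilde D,\tilde R$ are obtained from $\bar D,\bar R$ by replacing $\Sigma_r,W_r$ with $\tilde\Sigma_r,\tilde W_r$ everywhere (with the same $U,\Delta_K,\Gamma$). The perturbations $E_D\in\mathbb{R}^{K\times d}$, $E_R\in\mathbb{R}^{K\times r}$ are defined by $\tilde D=\bar D+\begin{bmatrix}E_D\\0_{d\times d}\end{bmatrix}$ and $\tilde R=\bar R+\begin{bmatrix}E_R\\0_{d\times r}\end{bmatrix}$. *)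

theory Defs
  imports Complex_Main "Jordan_Normal_Form.Matrix"
begin

section \<open>Norms\<close>

definition vec_norm2 :: "real vec \<Rightarrow> real" where
  "vec_norm2 v = sqrt (v \<bullet> v)"

definition spectral_norm :: "real mat \<Rightarrow> real" where
  "spectral_norm A =
     (SUP v \<in> {v \<in> carrier_vec (dim_col A). vec_norm2 v \<le> 1}. vec_norm2 (A *\<^sub>v v))"

definition frobenius_norm :: "real mat \<Rightarrow> real" where
  "frobenius_norm A = sqrt (\<Sum>i<dim_row A. \<Sum>j<dim_col A. (A $$ (i, j))\<^sup>2)"

section \<open>Moore--Penrose pseudoinverse\<close>

definition is_pinv :: "real mat \<Rightarrow> real mat \<Rightarrow> bool" where
  "is_pinv A P \<longleftrightarrow>
     P \<in> carrier_mat (dim_col A) (dim_row A) \<and>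
     A * P * A = A \<and> P * A * P = P \<and>
     transpose_mat (A * P) = A * P \<and> transpose_mat (P * A) = P * A"

definition pinv :: "real mat \<Rightarrow> real mat" where
  "pinv A = (THE P. is_pinv A P)"

lemma is_pinv_unique:
  assumes P: "is_pinv A P" and Q: "is_pinv A Q"
  shows "P = Q"
proof -
  define n m where "n = dim_row A" and "m = dim_col A"
  have A: "A \<in> carrier_mat n m" by (auto simp: n_def m_def)
  have cP: "P \<in> carrier_mat m n" and cQ: "Q \<in> carrier_mat m n"
    using P Q by (auto simp: is_pinv_def n_def m_def)
  note c = A cP cQ
  have "A * P = (A * Q * A) * P" using Q by (simp add: is_pinv_def)
  also have "\<dots> = (A * Q) * (A * P)" using c by (intro assoc_mult_mat) auto
  also have "\<dots> = transpose_mat (A * Q) * transpose_mat (A * P)"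
    using P Q by (simp add: is_pinv_def)
  also have "\<dots> = transpose_mat ((A * P) * (A * Q))"
    using c by (intro transpose_mult[symmetric]) auto
  also have "(A * P) * (A * Q) = A * P * A * Q"
    using c by (intro assoc_mult_mat[symmetric]) auto
  also have "A * P * A = A" using P by (simp add: is_pinv_def)
  also have "transpose_mat (A * Q) = A * Q" using Q by (simp add: is_pinv_def)
  finally have AP: "A * P = A * Q" .
  have "P * A = P * (A * Q * A)" using Q by (simp add: is_pinv_def)
  also have "A * Q * A = A * (Q * A)" using c by (intro assoc_mult_mat) auto
  also have "P * (A * (Q * A)) = (P * A) * (Q * A)"
    using c by (intro assoc_mult_mat[symmetric]) auto
  also have "\<dots> = transpose_mat (P * A) * transpose_mat (Q * A)"
    using P Q by (simp add: is_pinv_def)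
  also have "\<dots> = transpose_mat ((Q * A) * (P * A))"
    using c by (intro transpose_mult[symmetric]) auto
  also have "(Q * A) * (P * A) = Q * (A * (P * A))"
    using c by (intro assoc_mult_mat) auto
  also have "A * (P * A) = A * P * A" using c by (intro assoc_mult_mat[symmetric]) auto
  also have "A * P * A = A" using P by (simp add: is_pinv_def)
  also have "transpose_mat (Q * A) = Q * A" using Q by (simp add: is_pinv_def)
  finally have PA: "P * A = Q * A" .
  have "P = P * A * P" using P by (simp add: is_pinv_def)
  also have "\<dots> = Q * A * P" by (simp add: PA)
  also have "\<dots> = Q * (A * P)" using c by (intro assoc_mult_mat) auto
  also have "\<dots> = Q * (A * Q)" by (simp add: AP)
  also have "\<dots> = Q * A * Q" using c by (intro assoc_mult_mat[symmetric]) auto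
  also have "\<dots> = Q" using Q by (simp add: is_pinv_def)
  finally show ?thesis .
qed

lemma pinv_eqI: "is_pinv A P \<Longrightarrow> pinv A = P"
  unfolding pinv_def using is_pinv_unique by blast

section \<open>Kronecker and Khatri--Rao products\<close>

definition kron_vec :: "real vec \<Rightarrow> real vec \<Rightarrow> real vec" (infixl \<open>\<otimes>\<^sub>v\<close> 70) where
  "a \<otimes>\<^sub>v b = vec (dim_vec a * dim_vec b)
     (\<lambda>i. a $ (i div dim_vec b) * b $ (i mod dim_vec b))"

definition khatri_rao :: "real mat \<Rightarrow> real mat \<Rightarrow> real mat" (infixl \<open>\<odot>\<close> 70) where
  "A \<odot> B = mat_of_cols (dim_row A * dim_row B)
     (map (\<lambda>k. col A k \<otimes>\<^sub>v col B k) [0..<dim_col A])"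

section \<open>Singular value decompositions\<close>

text \<open>
  The number of columns of \<open>V\<close> and \<open>W\<close> is left open and \<open>S\<close> may be rectangular, so that full,
  thin and truncated decompositions are all covered. Indices start at 0: the largest singular
  value is \<open>S $$ (0, 0)\<close>.
\<close>

definition is_svd :: "real mat \<Rightarrow> real mat \<Rightarrow> real mat \<Rightarrow> real mat \<Rightarrow> bool" where
  "is_svd X V S W \<longleftrightarrow>
     dim_row V = dim_row X \<and> dim_row W = dim_col X \<and>
     S \<in> carrier_mat (dim_col V) (dim_col W) \<and>
     transpose_mat V * V = 1\<^sub>m (dim_col V) \<and>
     transpose_mat W * W = 1\<^sub>m (dim_col W) \<and>
     diagonal_mat S \<and>
     (\<forall>i < min (dim_row S) (dim_col S). 0 \<le> S $$ (i, i)) \<and>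
     (\<forall>i j. i \<le> j \<longrightarrow> j < min (dim_row S) (dim_col S) \<longrightarrow> S $$ (j, j) \<le> S $$ (i, i)) \<and>
     X = V * S * transpose_mat W"

definition leading_cols :: "nat \<Rightarrow> real mat \<Rightarrow> real mat" where
  "leading_cols r A = mat (dim_row A) r (\<lambda>(i, j). A $$ (i, j))"

definition truncated_svd ::
  "nat \<Rightarrow> real mat \<Rightarrow> real mat \<Rightarrow> real mat \<Rightarrow> real mat \<Rightarrow> real mat \<Rightarrow> real mat \<Rightarrow> bool"
  where
  "truncated_svd r V S W Vr Sr Wr \<longleftrightarrow>
     r \<le> dim_col V \<and> r \<le> dim_col W \<and>
     Vr = leading_cols r V \<and> Sr = mat_diag r (\<lambda>i. S $$ (i, i)) \<and> Wr = leading_cols r W"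

section \<open>Data matrices\<close>

definition append_cols :: "real mat \<Rightarrow> real mat \<Rightarrow> real mat" (infixr \<open>@\<^sub>c\<close> 65) where
  "A @\<^sub>c B = transpose_mat (transpose_mat A @\<^sub>r transpose_mat B)"

definition data_mat :: "real mat \<Rightarrow> real mat \<Rightarrow> real mat \<Rightarrow> real mat" where
  "data_mat Sr Wr U =
     (let Z = Sr * transpose_mat Wr in
        transpose_mat Z @\<^sub>c transpose_mat (Z \<odot> Z) @\<^sub>c transpose_mat U @\<^sub>c
        mat (dim_row Wr) 1 (\<lambda>_. 1))"

definition deriv_mat :: "real mat \<Rightarrow> real mat \<Rightarrow> real mat \<Rightarrow> real mat" where
  "deriv_mat Sr Wr \<Delta> = transpose_mat (Sr * transpose_mat Wr * \<Delta>)"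

text \<open>
  The lower block of \<open>reg_data_mat\<close> is the principal square root of the positive diagonal matrix
  with diagonal \<open>\<gamma> 0, \<dots>, \<gamma> (d - 1)\<close>.
\<close>

definition reg_data_mat :: "nat \<Rightarrow> (nat \<Rightarrow> real) \<Rightarrow> real mat \<Rightarrow> real mat \<Rightarrow> real mat \<Rightarrow> real mat" where
  "reg_data_mat d \<gamma> Sr Wr U = data_mat Sr Wr U @\<^sub>r mat_diag d (\<lambda>j. sqrt (\<gamma> j))"

definition reg_deriv_mat :: "nat \<Rightarrow> real mat \<Rightarrow> real mat \<Rightarrow> real mat \<Rightarrow> real mat" where
  "reg_deriv_mat d Sr Wr \<Delta> = deriv_mat Sr Wr \<Delta> @\<^sub>r 0\<^sub>m d (dim_row Sr)"

end

theory Submission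
  imports Defs "HOL-Analysis.L2_Norm" "Jordan_Normal_Form.Determinant"
begin

text \<open>
  Write \<open>Z = \<Sigma>\<^sub>r W\<^sub>r\<^sup>T\<close> and \<open>Z'\<close> for the exact and the streaming reduced data. Everything follows from one
  estimate, \<open>|Z' - Z|\<^sub>F \<le> e\<close> with \<open>e = \<sigma>\<^sub>1 \<tau>\<^sub>w + \<surd>r \<epsilon>\<close>. It is the triangle inequality for
  \<open>Z' - Z = \<Sigma>\<^sub>r (W'\<^sub>r - W\<^sub>r)\<^sup>T + (\<Sigma>'\<^sub>r - \<Sigma>\<^sub>r) W'\<^sub>r\<^sup>T\<close>, where Weyl's inequality
  (\<open>Weyl_singular_value_perturbation\<close>) bounds every singular value error by \<open>\<epsilon>\<close>, and \<open>W'\<^sub>r\<close> has Frobenius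
  norm \<open>\<surd>r\<close>. Weyl's inequality in turn is the Courant-Fischer dimension count for the two given
  decompositions.

  The derivative data perturbation is \<open>((Z' - Z) \<Delta>)\<^sup>T\<close>, of Frobenius norm at most \<open>|\<Delta>|\<^sub>2 e\<close>. In the data
  matrix perturbation the linear block is \<open>Z' - Z\<close> transposed, and in the quadratic block
  \<open>z' \<otimes> z' - z \<otimes> z = (z' - z) \<otimes> z' + z \<otimes> (z' - z)\<close> costs a factor \<open>|z'| + |z| \<le> 2\<sigma>\<^sub>1 + \<epsilon>\<close> in each snapshot
  (\<open>data_mat_perturbation\<close>). This gives \<open>|E\<^sub>D|\<^sub>2 \<le> |E\<^sub>D|\<^sub>F \<le> e \<surd>(1 + (2\<sigma>\<^sub>1 + \<epsilon>)\<^sup>2)\<close>, which is the first bound.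

  For the operators, the regularization rows make the augmented matrices injective, so each column
  of a solution is a ridge regression solution (\<open>ridge_solution_pinv\<close>). The augmented right-hand side
  vanishes on the regularization rows, and because of this an energy argument
  (\<open>ridge_data_perturbation\<close>) shows that changing \<open>D\<close> by \<open>E\<close> changes the solution by at
  most \<open>|E|\<^sub>2 |b| / \<gamma>\<^sub>m\<^sub>i\<^sub>n\<close>, and changing the right-hand side by \<open>c\<close> changes it by at most \<open>|c| / \<surd>\<gamma>\<^sub>m\<^sub>i\<^sub>n\<close>. With
  \<open>|R'|\<^sub>F \<le> \<surd>r (\<sigma>\<^sub>1 + \<epsilon>) |\<Delta>|\<^sub>2\<close> the total is the third bound with 1 in place of \<open>\<alpha>\<close>, and
  \<open>\<alpha> \<ge> 1\<close>.
\<close>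

section \<open>Euclidean and Frobenius norms\<close>

lemma vec_norm2_conv_L2_set: "vec_norm2 v = L2_set (($) v) {..<dim_vec v}"
  by (simp add: vec_norm2_def L2_set_def scalar_prod_def power2_eq_square lessThan_atLeast0)

lemma vec_norm2_nonneg [simp]: "0 \<le> vec_norm2 v"
  by (simp add: vec_norm2_conv_L2_set)

lemma scalar_prod_self_nonneg: "0 \<le> v \<bullet> (v :: real vec)"
  by (simp add: scalar_prod_def sum_nonneg)

lemma vec_norm2_square: "(vec_norm2 v)\<^sup>2 = v \<bullet> v"
  by (simp add: vec_norm2_def scalar_prod_self_nonneg)

lemma vec_norm2_square_sum: "(vec_norm2 v)\<^sup>2 = (\<Sum>i<dim_vec v. (v $ i)\<^sup>2)"
  unfolding vec_norm2_square scalar_prod_def lessThan_atLeast0 by (simp add: power2_eq_square)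

lemma vec_norm2_zero [simp]: "vec_norm2 (0\<^sub>v n) = 0"
  by (simp add: vec_norm2_def)

lemma vec_norm2_eq_0D:
  assumes "v \<in> carrier_vec n" "vec_norm2 v = 0" shows "v = 0\<^sub>v n"
  using assms by (auto simp: vec_norm2_conv_L2_set L2_set_eq_0_iff)

lemma vec_norm2_smult: "vec_norm2 (c \<cdot>\<^sub>v v) = \<bar>c\<bar> * vec_norm2 v"
  by (simp add: vec_norm2_def real_sqrt_mult flip: mult.assoc)

lemma vec_norm2_minus_commute:
  assumes "u \<in> carrier_vec n" "v \<in> carrier_vec n"
  shows "vec_norm2 (u - v) = vec_norm2 (v - u)"
proof -
  have "(\<Sum>i<n. ((u - v) $ i)\<^sup>2) = (\<Sum>i<n. ((v - u) $ i)\<^sup>2)"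
    using assms by (intro sum.cong) (simp_all add: power2_commute)
  then show ?thesis using assms by (simp add: vec_norm2_conv_L2_set L2_set_def)
qed

lemma vec_norm2_triangle:
  assumes "u \<in> carrier_vec n" "v \<in> carrier_vec n"
  shows "vec_norm2 (u + v) \<le> vec_norm2 u + vec_norm2 v"
proof -
  have "vec_norm2 (u + v) = L2_set (\<lambda>i. u $ i + v $ i) {..<n}"
    using assms unfolding vec_norm2_conv_L2_set by (intro L2_set_cong) auto
  then show ?thesis
    using L2_set_triangle_ineq[of "($) u" "($) v" "{..<n}"] assms
    by (simp add: vec_norm2_conv_L2_set)
qed

lemma scalar_prod_Cauchy_Schwarz:
  assumes "u \<in> carrier_vec n" "v \<in> carrier_vec n"
  shows "u \<bullet> v \<le> vec_norm2 u * vec_norm2 v"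
proof -
  have "u \<bullet> v \<le> (\<Sum>i<n. \<bar>u $ i\<bar> * \<bar>v $ i\<bar>)"
    using assms
    by (auto simp: scalar_prod_def lessThan_atLeast0 simp flip: abs_mult intro!: sum_mono)
  also have "\<dots> \<le> vec_norm2 u * vec_norm2 v"
    using L2_set_mult_ineq[of "($) u" "($) v" "{..<n}"] assms
    by (simp add: vec_norm2_conv_L2_set)
  finally show ?thesis .
qed

lemma frobenius_norm_conv_L2_set:
  "frobenius_norm A = L2_set (($$) A) ({..<dim_row A} \<times> {..<dim_col A})"
  by (simp add: frobenius_norm_def L2_set_def sum.cartesian_product)

lemma frobenius_norm_nonneg [simp]: "0 \<le> frobenius_norm A"
  by (simp add: frobenius_norm_conv_L2_set)

lemma frobenius_norm_square_rows:
  "(frobenius_norm A)\<^sup>2 = (\<Sum>i<dim_row A. (vec_norm2 (row A i))\<^sup>2)"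
  unfolding frobenius_norm_def
  by (subst real_sqrt_pow2) (auto simp: vec_norm2_square_sum intro!: sum_nonneg)

lemma frobenius_norm_square_cols:
  "(frobenius_norm A)\<^sup>2 = (\<Sum>j<dim_col A. (vec_norm2 (col A j))\<^sup>2)"
  unfolding frobenius_norm_def
  by (subst real_sqrt_pow2, force intro!: sum_nonneg, subst sum.swap)
     (auto simp: vec_norm2_square_sum)

lemma frobenius_norm_transpose: "frobenius_norm (transpose_mat A) = frobenius_norm A"
  unfolding frobenius_norm_def by (subst sum.swap) (auto intro!: sum.cong)

lemma frobenius_norm_minus_commute:
  assumes "A \<in> carrier_mat p q" "B \<in> carrier_mat p q"
  shows "frobenius_norm (A - B) = frobenius_norm (B - A)"
proof -
  have "(\<Sum>i<p. \<Sum>j<q. ((A - B) $$ (i, j))\<^sup>2) = (\<Sum>i<p. \<Sum>j<q. ((B - A) $$ (i, j))\<^sup>2)"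
    using assms by (intro sum.cong refl) (simp add: power2_commute)
  then show ?thesis using assms by (simp add: frobenius_norm_def)
qed

lemma frobenius_norm_triangle:
  assumes "A \<in> carrier_mat p q" "B \<in> carrier_mat p q"
  shows "frobenius_norm (A + B) \<le> frobenius_norm A + frobenius_norm B"
proof -
  have "frobenius_norm (A + B) = L2_set (\<lambda>ij. A $$ ij + B $$ ij) ({..<p} \<times> {..<q})"
    using assms unfolding frobenius_norm_conv_L2_set by (intro L2_set_cong) auto
  then show ?thesis
    using L2_set_triangle_ineq[of "($$) A" "($$) B" "{..<p} \<times> {..<q}"] assms
    by (simp add: frobenius_norm_conv_L2_set)
qed

lemma frobenius_norm_le_by_cols:
  assumes "dim_col A = dim_col B" "0 \<le> c"
    and "\<And>j. j < dim_col B \<Longrightarrow> vec_norm2 (col A j) \<le> c * vec_norm2 (col B j)"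
  shows "frobenius_norm A \<le> c * frobenius_norm B"
proof (rule power2_le_imp_le)
  have "(frobenius_norm A)\<^sup>2 \<le> (\<Sum>j<dim_col B. (c * vec_norm2 (col B j))\<^sup>2)"
    unfolding frobenius_norm_square_cols assms(1) using assms by (intro sum_mono power_mono) auto
  then show "(frobenius_norm A)\<^sup>2 \<le> (c * frobenius_norm B)\<^sup>2"
    by (simp add: power_mult_distrib frobenius_norm_square_cols flip: sum_distrib_left)
qed (simp add: assms)

lemma vec_norm2_mult_le_frobenius:
  assumes "v \<in> carrier_vec (dim_col A)"
  shows "vec_norm2 (A *\<^sub>v v) \<le> frobenius_norm A * vec_norm2 v"
proof (rule power2_le_imp_le)
  have "(row A i \<bullet> v)\<^sup>2 \<le> (vec_norm2 (row A i) * vec_norm2 v)\<^sup>2" for i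
  proof -
    have "- (row A i \<bullet> v) = row A i \<bullet> (- v)" using assms by simp
    also have "\<dots> \<le> vec_norm2 (row A i) * vec_norm2 (- v)"
      using assms by (intro scalar_prod_Cauchy_Schwarz[of _ "dim_col A"]) auto
    also have "vec_norm2 (- v) = vec_norm2 v"
      using assms by (simp add: vec_norm2_def)
    finally have "- (row A i \<bullet> v) \<le> vec_norm2 (row A i) * vec_norm2 v" .
    moreover have "row A i \<bullet> v \<le> vec_norm2 (row A i) * vec_norm2 v"
      using assms by (intro scalar_prod_Cauchy_Schwarz[of _ "dim_col A"]) auto
    ultimately show ?thesis by (intro power2_le_iff_abs_le[THEN iffD2]) auto
  qed
  then have "(vec_norm2 (A *\<^sub>v v))\<^sup>2 \<le> (\<Sum>i<dim_row A. (vec_norm2 (row A i) * vec_norm2 v)\<^sup>2)"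
    unfolding vec_norm2_square_sum by (auto intro!: sum_mono)
  then show "(vec_norm2 (A *\<^sub>v v))\<^sup>2 \<le> (frobenius_norm A * vec_norm2 v)\<^sup>2"
    by (simp add: power_mult_distrib frobenius_norm_square_rows flip: sum_distrib_right)
qed simp

section \<open>The spectral norm as an operator norm\<close>

text \<open>
  The spectral norm is a supremum of reals, which says something only for a set that is bounded
  above; the Frobenius norm is such a bound.
\<close>

lemma bdd_above_spectral_norm:
  "bdd_above ((\<lambda>v. vec_norm2 (A *\<^sub>v v)) ` {v \<in> carrier_vec (dim_col A). vec_norm2 v \<le> 1})"
proof (rule bdd_aboveI2)
  fix v assume v: "v \<in> {v \<in> carrier_vec (dim_col A). vec_norm2 v \<le> 1}"
  then have "vec_norm2 (A *\<^sub>v v) \<le> frobenius_norm A * vec_norm2 v"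
    by (intro vec_norm2_mult_le_frobenius) auto
  also have "\<dots> \<le> frobenius_norm A" using v by (auto intro: mult_left_le)
  finally show "vec_norm2 (A *\<^sub>v v) \<le> frobenius_norm A" .
qed

lemma spectral_norm_upper:
  assumes "v \<in> carrier_vec (dim_col A)" "vec_norm2 v \<le> 1"
  shows "vec_norm2 (A *\<^sub>v v) \<le> spectral_norm A"
  unfolding spectral_norm_def
  using assms by (intro cSUP_upper bdd_above_spectral_norm) auto

lemma spectral_norm_nonneg [simp]: "0 \<le> spectral_norm A"
  by (rule order_trans[OF vec_norm2_nonneg spectral_norm_upper[of "0\<^sub>v (dim_col A)"]]) auto

lemma vec_norm2_mult_le_spectral:
  assumes v: "v \<in> carrier_vec (dim_col A)"
  shows "vec_norm2 (A *\<^sub>v v) \<le> spectral_norm A * vec_norm2 v"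
proof (cases "vec_norm2 v = 0")
  case True
  with v have "v = 0\<^sub>v (dim_col A)" by (rule vec_norm2_eq_0D)
  then have "A *\<^sub>v v = 0\<^sub>v (dim_row A)" by auto
  then show ?thesis by simp
next
  case False
  define u where "u = (1 / vec_norm2 v) \<cdot>\<^sub>v v"
  have "A *\<^sub>v u = (1 / vec_norm2 v) \<cdot>\<^sub>v (A *\<^sub>v v)"
    unfolding u_def using v by (intro mult_mat_vec) auto
  moreover have "vec_norm2 (A *\<^sub>v u) \<le> spectral_norm A"
    using v False by (intro spectral_norm_upper) (auto simp: u_def vec_norm2_smult)
  moreover have "0 < vec_norm2 v" using False vec_norm2_nonneg[of v] by linarith
  ultimately show ?thesis
    by (simp add: vec_norm2_smult pos_divide_le_eq)
qed

lemma spectral_norm_le_frobenius: "spectral_norm A \<le> frobenius_norm A"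
  unfolding spectral_norm_def
proof (rule cSUP_least)
  show "{v \<in> carrier_vec (dim_col A). vec_norm2 v \<le> 1} \<noteq> {}"
    using zero_carrier_vec[of "dim_col A"] by (force simp del: zero_carrier_vec)
  fix v assume v: "v \<in> {v \<in> carrier_vec (dim_col A). vec_norm2 v \<le> 1}"
  then have "vec_norm2 (A *\<^sub>v v) \<le> frobenius_norm A * vec_norm2 v"
    by (intro vec_norm2_mult_le_frobenius) auto
  also have "\<dots> \<le> frobenius_norm A" using v by (auto intro: mult_left_le)
  finally show "vec_norm2 (A *\<^sub>v v) \<le> frobenius_norm A" .
qed

text \<open>
  Use \<open>|A\<^sup>T v|\<^sup>2 = v \<bullet> A (A\<^sup>T v) \<le> |v| c |A\<^sup>T v|\<close> and cancel one factor \<open>|A\<^sup>T v|\<close>.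
\<close>

lemma vec_norm2_transpose_mult_le:
  assumes "\<And>u. u \<in> carrier_vec (dim_col A) \<Longrightarrow> vec_norm2 (A *\<^sub>v u) \<le> c * vec_norm2 u"
    and v: "v \<in> carrier_vec (dim_row A)" and "0 \<le> c"
  shows "vec_norm2 (transpose_mat A *\<^sub>v v) \<le> c * vec_norm2 v"
proof -
  define t where "t = transpose_mat A *\<^sub>v v"
  have t: "t \<in> carrier_vec (dim_col A)" by (rule carrier_vecI) (simp add: t_def)
  have At: "A *\<^sub>v t \<in> carrier_vec (dim_row A)" by (rule carrier_vecI) simp
  have "(vec_norm2 t)\<^sup>2 = v \<bullet> (A *\<^sub>v t)"
    unfolding vec_norm2_square
    using transpose_vec_mult_scalar[of A "dim_row A" "dim_col A" t v] t v
    by (simp add: t_def)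
  also have "\<dots> \<le> vec_norm2 v * vec_norm2 (A *\<^sub>v t)"
    using v At by (rule scalar_prod_Cauchy_Schwarz)
  also have "\<dots> \<le> vec_norm2 v * (c * vec_norm2 t)"
    using assms(1)[OF t] by (intro mult_left_mono) auto
  finally have "vec_norm2 t * vec_norm2 t \<le> (c * vec_norm2 v) * vec_norm2 t"
    by (simp add: power2_eq_square algebra_simps)
  then show ?thesis unfolding t_def[symmetric]
    using \<open>0 \<le> c\<close> vec_norm2_nonneg[of t]
    by (cases "vec_norm2 t = 0") (auto intro: mult_right_le_imp_le)
qed

text \<open>
  The columns of \<open>(A B)\<^sup>T = B\<^sup>T A\<^sup>T\<close> are the images under \<open>B\<^sup>T\<close> of the rows of \<open>A\<close>, so the
  estimate reduces to the operator norm of \<open>B\<^sup>T\<close>, column by column. The transposed form is the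
  one in which the derivative data occur.
\<close>

lemma frobenius_norm_mult_le_spectral:
  assumes "A \<in> carrier_mat p q" "B \<in> carrier_mat q s"
  shows "frobenius_norm (transpose_mat (A * B)) \<le> spectral_norm B * frobenius_norm A"
proof -
  have "frobenius_norm (transpose_mat (A * B)) \<le> spectral_norm B * frobenius_norm (transpose_mat A)"
  proof (rule frobenius_norm_le_by_cols)
    fix j assume "j < dim_col (transpose_mat A)"
    then have "col (transpose_mat (A * B)) j = transpose_mat B *\<^sub>v row A j"
      using assms transpose_mult[OF assms] by (intro eq_vecI) auto
    then show "vec_norm2 (col (transpose_mat (A * B)) j)
        \<le> spectral_norm B * vec_norm2 (col (transpose_mat A) j)"
      using assms vec_norm2_transpose_mult_le[OF vec_norm2_mult_le_spectral, of B "row A j"]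
        \<open>j < dim_col (transpose_mat A)\<close>
      by auto
  qed (use assms in auto)
  then show ?thesis by (simp add: frobenius_norm_transpose)
qed

section \<open>Least squares through the pseudoinverse\<close>

text \<open>
  For full column rank the Gram matrix \<open>A\<^sup>T A\<close> is invertible, since \<open>A\<^sup>T A v = 0\<close> gives
  \<open>|A v|\<^sup>2 = v \<bullet> A\<^sup>T A v = 0\<close>. Then \<open>(A\<^sup>T A)\<^sup>-\<^sup>1 A\<^sup>T\<close> satisfies the four Penrose equations.
\<close>

lemma is_pinv_pinv_full_column_rank:
  assumes A: "A \<in> carrier_mat p q"
    and inj: "\<And>v. v \<in> carrier_vec q \<Longrightarrow> A *\<^sub>v v = 0\<^sub>v p \<Longrightarrow> v = 0\<^sub>v q"
  shows "is_pinv A (pinv A)"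
proof -
  define N where "N = transpose_mat A * A"
  have N: "N \<in> carrier_mat q q" using A by (auto simp: N_def)
  have "det N \<noteq> 0"
  proof
    assume "det N = 0"
    then obtain v where v: "v \<in> carrier_vec q" "v \<noteq> 0\<^sub>v q" "N *\<^sub>v v = 0\<^sub>v q"
      using det_0_iff_vec_prod_zero[OF N] by auto
    have Av: "A *\<^sub>v v \<in> carrier_vec p" using A v by auto
    have "(vec_norm2 (A *\<^sub>v v))\<^sup>2 = (transpose_mat A *\<^sub>v (A *\<^sub>v v)) \<bullet> v"
      unfolding vec_norm2_square using transpose_vec_mult_scalar[OF A v(1) Av] by simp
    also have "transpose_mat A *\<^sub>v (A *\<^sub>v v) = N *\<^sub>v v"
      using A v(1) by (simp add: N_def)
    finally have "vec_norm2 (A *\<^sub>v v) = 0" using v by simp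
    then show False using vec_norm2_eq_0D[OF Av] inj v by blast
  qed
  then have "N \<in> Units (ring_mat TYPE(real) q ())" by (rule det_non_zero_imp_unit[OF N])
  then obtain M where M: "M \<in> carrier_mat q q" "M * N = 1\<^sub>m q" "N * M = 1\<^sub>m q"
    by (auto simp: Units_def ring_mat_def)
  have Nt: "transpose_mat N = N" using A by (simp add: N_def transpose_mult[of _ q p])
  have Mt: "transpose_mat M = M"
  proof -
    have tM: "transpose_mat M \<in> carrier_mat q q" using M by auto
    have "transpose_mat M = transpose_mat M * (N * M)" using tM M by simp
    also have "\<dots> = (transpose_mat M * transpose_mat N) * M" using tM N M Nt by simp
    also have "transpose_mat M * transpose_mat N = transpose_mat (N * M)"
      using transpose_mult[OF N M(1)] by simp
    finally show ?thesis using M by simp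
  qed
  define P where "P = M * transpose_mat A"
  have P: "P \<in> carrier_mat q p" using A M by (auto simp: P_def)
  have tA: "transpose_mat A \<in> carrier_mat q p" using A by auto
  have PA: "P * A = 1\<^sub>m q" using A tA M by (simp add: P_def flip: N_def)
  have "is_pinv A P"
    unfolding is_pinv_def
  proof (intro conjI)
    show "P \<in> carrier_mat (dim_col A) (dim_row A)" using A P by auto
    show "A * P * A = A" using A P PA by simp
    show "P * A * P = P" using A P PA by simp
    show "transpose_mat (P * A) = P * A" by (simp add: PA)
    have "transpose_mat (A * P) = transpose_mat P * transpose_mat A"
      by (rule transpose_mult[OF A P])
    also have "transpose_mat P = A * M"
      unfolding P_def using transpose_mult[OF M(1) tA] by (simp add: Mt)
    finally show "transpose_mat (A * P) = A * P"
      using A M tA by (simp add: P_def)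
  qed
  then show ?thesis using pinv_eqI by simp
qed

text \<open>
  The matrix \<open>A P\<close> is symmetric and fixes the range of \<open>A\<close>, so it is the orthogonal projection onto
  this range, and the residual \<open>b - A P b\<close> is orthogonal to it.
\<close>

lemma pinv_residual_orthogonal:
  assumes A: "A \<in> carrier_mat p q" and P: "is_pinv A P"
    and b: "b \<in> carrier_vec p" and w: "w \<in> carrier_vec q"
  shows "(A *\<^sub>v w) \<bullet> (b - A *\<^sub>v (P *\<^sub>v b)) = 0"
proof -
  have cP: "P \<in> carrier_mat q p" using A P by (auto simp: is_pinv_def)
  have Aw: "A *\<^sub>v w \<in> carrier_vec p" and Pb: "P *\<^sub>v b \<in> carrier_vec q"
    and APb: "A *\<^sub>v (P *\<^sub>v b) \<in> carrier_vec p" using A cP w b by auto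
  have "(A *\<^sub>v w) \<bullet> (A *\<^sub>v (P *\<^sub>v b)) = (A *\<^sub>v w) \<bullet> ((A * P) *\<^sub>v b)"
    using A cP b by simp
  also have "\<dots> = (transpose_mat (A * P) *\<^sub>v (A *\<^sub>v w)) \<bullet> b"
    using transpose_vec_mult_scalar[of "A * P" p p b "A *\<^sub>v w"] A cP b Aw by simp
  also have "transpose_mat (A * P) = A * P" using P by (simp add: is_pinv_def)
  also have "(A * P) *\<^sub>v (A *\<^sub>v w) = (A * P * A) *\<^sub>v w"
    by (rule assoc_mult_mat_vec[symmetric, of _ p p _ q]) (use A cP w in auto)
  also have "A * P * A = A" using P by (simp add: is_pinv_def)
  finally show ?thesis
    using scalar_prod_minus_distrib[OF Aw b APb] by simp
qed

section \<open>Ridge regression and its stability\<close>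

text \<open>
  The weak form of the normal equations \<open>(D\<^sup>T D + \<Gamma>) x = D\<^sup>T b\<close>, where \<open>\<Gamma>\<close> has the diagonal \<open>\<gamma>\<close>:
  the equation is tested against every direction \<open>w\<close>. All estimates below come from choosing \<open>w\<close>,
  and no inverse has to be handled.
\<close>

definition ridge_solution ::
  "real mat \<Rightarrow> (nat \<Rightarrow> real) \<Rightarrow> real vec \<Rightarrow> real vec \<Rightarrow> bool" where
  "ridge_solution D \<gamma> b x \<longleftrightarrow>
     x \<in> carrier_vec (dim_col D) \<and>
     (\<forall>w \<in> carrier_vec (dim_col D).
        (D *\<^sub>v w) \<bullet> (b - D *\<^sub>v x) = (\<Sum>i<dim_col D. \<gamma> i * (w $ i * x $ i)))"

lemma mult_mat_diag_vec_nth: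
  fixes f :: "nat \<Rightarrow> real"
  assumes "v \<in> carrier_vec d" "i < d"
  shows "(mat_diag d f *\<^sub>v v) $ i = f i * v $ i"
proof -
  have "(mat_diag d f *\<^sub>v v) $ i = (\<Sum>k<d. (if i = k then f k else 0) * v $ k)"
    using assms by (auto simp: mat_diag_def scalar_prod_def lessThan_atLeast0 intro!: sum.cong)
  also have "\<dots> = (\<Sum>k<d. if i = k then f k * v $ k else 0)"
    by (intro sum.cong) auto
  finally show ?thesis using assms by simp
qed

lemma is_pinv_regularized:
  assumes D: "D \<in> carrier_mat K d" and \<gamma>: "\<And>j. j < d \<Longrightarrow> 0 < \<gamma> j"
  defines "A \<equiv> D @\<^sub>r mat_diag d (\<lambda>i. sqrt (\<gamma> i))"
  shows "is_pinv A (pinv A)"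
proof -
  let ?G = "mat_diag d (\<lambda>i. sqrt (\<gamma> i))"
  have A: "A \<in> carrier_mat (K + d) d" using D by (auto simp: A_def)
  show ?thesis
  proof (rule is_pinv_pinv_full_column_rank[OF A])
    fix v assume v: "v \<in> carrier_vec d" and "A *\<^sub>v v = 0\<^sub>v (K + d)"
    then have z: "(D *\<^sub>v v @\<^sub>v ?G *\<^sub>v v) $ (K + i) = 0" if "i < d" for i
      using mat_mult_append[OF D mat_diag_dim v, of "\<lambda>i. sqrt (\<gamma> i)"] that by (simp add: A_def)
    show "v = 0\<^sub>v d"
    proof (rule eq_vecI)
      fix i assume i: "i < dim_vec (0\<^sub>v d :: real vec)"
      then have "(?G *\<^sub>v v) $ i = 0" using z[of i] D by (simp add: mat_diag_def)
      then show "v $ i = 0\<^sub>v d $ i"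
        using mult_mat_diag_vec_nth[OF v, of i "\<lambda>i. sqrt (\<gamma> i)"] \<gamma>[of i] i by simp
    qed (use v in simp)
  qed
qed

lemma pinv_regularized_carrier:
  assumes D: "D \<in> carrier_mat K d" and \<gamma>: "\<And>j. j < d \<Longrightarrow> 0 < \<gamma> j"
  shows "pinv (D @\<^sub>r mat_diag d (\<lambda>i. sqrt (\<gamma> i))) \<in> carrier_mat d (K + d)"
proof -
  let ?A = "D @\<^sub>r mat_diag d (\<lambda>i. sqrt (\<gamma> i))"
  have "is_pinv ?A (pinv ?A)" by (rule is_pinv_regularized[of D K d \<gamma>, OF D \<gamma>])
  then have "pinv ?A \<in> carrier_mat (dim_col ?A) (dim_row ?A)" unfolding is_pinv_def by blast
  moreover have "?A \<in> carrier_mat (K + d) d" by (rule carrier_append_rows[OF D mat_diag_dim])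
  ultimately show ?thesis by (simp only: carrier_matD)
qed

text \<open>
  The augmented least squares problem with matrix \<open>[D; \<Gamma>\<^sup>1\<^sup>/\<^sup>2]\<close> and right-hand side \<open>[b; 0]\<close> is the
  ridge problem: orthogonality of the augmented residual splits into the contribution of the data
  rows and that of the regularization rows.
\<close>

lemma ridge_solution_pinv:
  assumes D: "D \<in> carrier_mat K d" and \<gamma>: "\<And>j. j < d \<Longrightarrow> 0 < \<gamma> j"
    and B: "B \<in> carrier_mat K s" and j: "j < s"
  shows "ridge_solution D \<gamma> (col B j)
           (col (pinv (D @\<^sub>r mat_diag d (\<lambda>i. sqrt (\<gamma> i))) * (B @\<^sub>r 0\<^sub>m d s)) j)"
proof -
  let ?G = "mat_diag d (\<lambda>i. sqrt (\<gamma> i))" and ?b = "col B j"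
  define A where "A = D @\<^sub>r ?G"
  define C where "C = B @\<^sub>r 0\<^sub>m d s"
  have A: "A \<in> carrier_mat (K + d) d" and C: "C \<in> carrier_mat (K + d) s"
    using D B by (auto simp: A_def C_def)
  have G_nth: "(?G *\<^sub>v v) $ i = sqrt (\<gamma> i) * v $ i" if "v \<in> carrier_vec d" "i < d" for v i
    by (rule mult_mat_diag_vec_nth[OF that])
  have Av: "A *\<^sub>v v = D *\<^sub>v v @\<^sub>v ?G *\<^sub>v v" if "v \<in> carrier_vec d" for v
    unfolding A_def by (rule mat_mult_append[OF D mat_diag_dim that])
  have pi: "is_pinv A (pinv A)" unfolding A_def by (rule is_pinv_regularized[of D K d \<gamma>, OF D \<gamma>])
  have cP: "pinv A \<in> carrier_mat d (K + d)"
    unfolding A_def by (rule pinv_regularized_carrier[of D K d \<gamma>, OF D \<gamma>])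
  define x where "x = pinv A *\<^sub>v col C j"
  have colC_carrier: "col C j \<in> carrier_vec (K + d)" using C j by simp
  have x: "x \<in> carrier_vec d" unfolding x_def by (rule mult_mat_vec_carrier[OF cP colC_carrier])
  have colC: "col C j = ?b @\<^sub>v 0\<^sub>v d"
    using B j by (intro eq_vecI) (auto simp: C_def append_rows_def)
  have Gc: "?G *\<^sub>v v \<in> carrier_vec d" if "v \<in> carrier_vec d" for v
    by (rule mult_mat_vec_carrier[OF mat_diag_dim that])
  have "(D *\<^sub>v w) \<bullet> (?b - D *\<^sub>v x) = (\<Sum>i<d. \<gamma> i * (w $ i * x $ i))"
    if w: "w \<in> carrier_vec d" for w
  proof -
    have eq: "col C j - A *\<^sub>v x = (?b - D *\<^sub>v x) @\<^sub>v (0\<^sub>v d - ?G *\<^sub>v x)"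
      unfolding colC Av[OF x] using D B by (intro eq_vecI) (auto simp: mat_diag_def)
    have "0 = (A *\<^sub>v w) \<bullet> (col C j - A *\<^sub>v x)"
      unfolding x_def by (rule pinv_residual_orthogonal[OF A pi colC_carrier w, symmetric])
    also have "\<dots> = (D *\<^sub>v w) \<bullet> (?b - D *\<^sub>v x) + (?G *\<^sub>v w) \<bullet> (0\<^sub>v d - ?G *\<^sub>v x)"
      unfolding eq Av[OF w] using D B w x Gc
      by (intro scalar_prod_append[of _ K _ d]) auto
    also have "(?G *\<^sub>v w) \<bullet> (0\<^sub>v d - ?G *\<^sub>v x) = (\<Sum>i<d. - (\<gamma> i * (w $ i * x $ i)))"
      unfolding scalar_prod_def
    proof (rule sum.cong)
      show "{0..<dim_vec (0\<^sub>v d - ?G *\<^sub>v x)} = {..<d}" by (auto simp: mat_diag_def)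
      fix i assume "i \<in> {..<d}"
      then have i: "i < d" by simp
      have "(0\<^sub>v d - ?G *\<^sub>v x) $ i = - (sqrt (\<gamma> i) * x $ i)"
        using i G_nth[OF x i] by (simp add: mat_diag_def)
      moreover have "sqrt (\<gamma> i) * sqrt (\<gamma> i) = \<gamma> i" using \<gamma>[OF i] by simp
      ultimately show "(?G *\<^sub>v w) $ i * (0\<^sub>v d - ?G *\<^sub>v x) $ i = - (\<gamma> i * (w $ i * x $ i))"
        using G_nth[OF w i] by (simp add: algebra_simps)
    qed
    finally show ?thesis by (simp add: sum_negf)
  qed
  moreover have "col (pinv A * C) j = x" using cP C j unfolding x_def by (intro col_mult2) auto
  ultimately show ?thesis
    using D x unfolding ridge_solution_def A_def C_def by auto
qed

lemma ridge_solution_minus: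
  assumes D: "D \<in> carrier_mat K d" and b: "b \<in> carrier_vec K" "b' \<in> carrier_vec K"
    and "ridge_solution D \<gamma> b x" "ridge_solution D \<gamma> b' x'"
  shows "ridge_solution D \<gamma> (b - b') (x - x')"
proof -
  have x: "x \<in> carrier_vec d" "x' \<in> carrier_vec d"
    using assms by (auto simp: ridge_solution_def)
  have "(D *\<^sub>v w) \<bullet> ((b - b') - D *\<^sub>v (x - x')) = (\<Sum>i<d. \<gamma> i * (w $ i * (x - x') $ i))"
    if w: "w \<in> carrier_vec d" for w
  proof -
    have c: "D *\<^sub>v w \<in> carrier_vec K" "D *\<^sub>v x \<in> carrier_vec K" "D *\<^sub>v x' \<in> carrier_vec K"
      using D x w by auto
    have "(b - b') - D *\<^sub>v (x - x') = (b - D *\<^sub>v x) - (b' - D *\<^sub>v x')"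
      unfolding mult_minus_distrib_mat_vec[OF D x] using D b c by (intro eq_vecI) auto
    then have "(D *\<^sub>v w) \<bullet> ((b - b') - D *\<^sub>v (x - x'))
        = (D *\<^sub>v w) \<bullet> (b - D *\<^sub>v x) - (D *\<^sub>v w) \<bullet> (b' - D *\<^sub>v x')"
      using b c by (simp add: scalar_prod_minus_distrib[of _ K])
    also have "\<dots> = (\<Sum>i<d. \<gamma> i * (w $ i * x $ i)) - (\<Sum>i<d. \<gamma> i * (w $ i * x' $ i))"
      using assms w by (simp add: ridge_solution_def)
    also have "\<dots> = (\<Sum>i<d. \<gamma> i * (w $ i * (x - x') $ i))"
      using x by (auto simp: algebra_simps simp flip: sum_subtractf intro!: sum.cong)
    finally show ?thesis .
  qed
  then show ?thesis using D x by (auto simp: ridge_solution_def)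
qed

lemma ridge_weight_lower:
  assumes "x \<in> carrier_vec d" "\<And>i. i < d \<Longrightarrow> g \<le> \<gamma> i"
  shows "g * (vec_norm2 x)\<^sup>2 \<le> (\<Sum>i<d. \<gamma> i * (x $ i * x $ i))"
  using assms unfolding vec_norm2_square_sum sum_distrib_left
  by (auto simp: power2_eq_square intro!: sum_mono mult_right_mono)

text \<open>
  At the minimizer the objective \<open>|b - D y|\<^sup>2 + \<Sum> \<gamma>\<^sub>i y\<^sub>i\<^sup>2\<close> is at most its value at \<open>y = 0\<close>: to
  see this, expand \<open>|b|\<^sup>2\<close> along \<open>b = (b - D x) + D x\<close> and test the normal equations with \<open>w = x\<close>.
\<close>

lemma ridge_energy:
  assumes D: "D \<in> carrier_mat K d" and b: "b \<in> carrier_vec K"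
    and g: "\<And>i. i < d \<Longrightarrow> g \<le> \<gamma> i" and "0 \<le> g" and sol: "ridge_solution D \<gamma> b x"
  shows "(vec_norm2 (b - D *\<^sub>v x))\<^sup>2 + g * (vec_norm2 x)\<^sup>2 \<le> (vec_norm2 b)\<^sup>2"
proof -
  have x: "x \<in> carrier_vec d" using D sol by (auto simp: ridge_solution_def)
  define y where "y = D *\<^sub>v x"
  define \<rho> where "\<rho> = b - y"
  have c: "y \<in> carrier_vec K" "\<rho> \<in> carrier_vec K" using D x b by (auto simp: y_def \<rho>_def)
  have by_sum: "b = \<rho> + y" using b c by (intro eq_vecI) (auto simp: \<rho>_def)
  have "y \<bullet> \<rho> = (\<Sum>i<d. \<gamma> i * (x $ i * x $ i))"
    using sol D x by (auto simp: ridge_solution_def y_def \<rho>_def)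
  then have lower: "g * (vec_norm2 x)\<^sup>2 \<le> y \<bullet> \<rho>" using ridge_weight_lower[OF x g] by simp
  have "b \<bullet> b = \<rho> \<bullet> \<rho> + 2 * (y \<bullet> \<rho>) + y \<bullet> y"
    unfolding by_sum using c comm_scalar_prod[OF c]
    by (simp add: add_scalar_prod_distrib[of _ K] scalar_prod_add_distrib[of _ K])
  moreover have "0 \<le> g * (vec_norm2 x)\<^sup>2" using \<open>0 \<le> g\<close> by simp
  ultimately show ?thesis
    using lower scalar_prod_self_nonneg[of y]
    by (simp add: vec_norm2_square flip: y_def \<rho>_def)
qed

lemma ridge_solution_bound:
  assumes "D \<in> carrier_mat K d" "b \<in> carrier_vec K"
    and "\<And>i. i < d \<Longrightarrow> g \<le> \<gamma> i" and "0 < g" and "ridge_solution D \<gamma> b x"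
  shows "vec_norm2 x \<le> 1 / sqrt g * vec_norm2 b"
proof -
  have "g * (vec_norm2 x)\<^sup>2 \<le> (vec_norm2 b)\<^sup>2"
    using ridge_energy[OF assms(1,2,3) _ assms(5)] assms(4) zero_le_power2[of "vec_norm2 (b - D *\<^sub>v x)"]
    by linarith
  then have "(sqrt g * vec_norm2 x)\<^sup>2 \<le> (vec_norm2 b)\<^sup>2"
    using \<open>0 < g\<close> by (simp add: power_mult_distrib)
  then have "sqrt g * vec_norm2 x \<le> vec_norm2 b" by (rule power2_le_imp_le) simp
  then show ?thesis using \<open>0 < g\<close> by (simp add: pos_le_divide_eq mult.commute)
qed

text \<open>
  Subtracting the two weak normal equations and testing with
  \<open>\<delta> = x' - x\<close> gives, for \<open>E = D' - D\<close> and \<open>\<rho> = b - D' x'\<close>,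
  \<open>|D \<delta>|\<^sup>2 + \<Sum> \<gamma>\<^sub>i \<delta>\<^sub>i\<^sup>2 = E \<delta> \<bullet> \<rho> - D \<delta> \<bullet> E x'\<close>.
  The right-hand side is at most \<open>N (|\<delta>| |\<rho>| + |D \<delta>| |x'|)\<close>. Cauchy-Schwarz in the plane pairs
  \<open>(|D \<delta>|, \<surd>g |\<delta>|)\<close>, whose length the left-hand side dominates, with \<open>(\<surd>g |x'|, |\<rho>|)\<close>, whose length
  is at most \<open>|b|\<close> by the energy estimate. Using both components at once, instead of bounding the
  two terms one after the other, is what yields the constant 1.
\<close>

lemma ridge_data_perturbation:
  assumes D: "D \<in> carrier_mat K d" and D': "D' \<in> carrier_mat K d"
    and b: "b \<in> carrier_vec K"
    and g: "\<And>i. i < d \<Longrightarrow> g \<le> \<gamma> i" and "0 < g"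
    and sol: "ridge_solution D \<gamma> b x" and sol': "ridge_solution D' \<gamma> b x'"
    and N: "\<And>v. v \<in> carrier_vec d \<Longrightarrow> vec_norm2 (D' *\<^sub>v v - D *\<^sub>v v) \<le> N * vec_norm2 v"
    and "0 \<le> N"
  shows "vec_norm2 (x - x') \<le> N / g * vec_norm2 b"
proof -
  have x: "x \<in> carrier_vec d" "x' \<in> carrier_vec d"
    using sol sol' D D' by (auto simp: ridge_solution_def)
  define \<delta> where "\<delta> = x' - x"
  define \<rho> where "\<rho> = b - D' *\<^sub>v x'"
  have \<delta>: "\<delta> \<in> carrier_vec d" using x by (simp add: \<delta>_def)
  have c: "D *\<^sub>v x \<in> carrier_vec K" "D *\<^sub>v x' \<in> carrier_vec K" "D' *\<^sub>v x' \<in> carrier_vec K"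
    "D *\<^sub>v \<delta> \<in> carrier_vec K" "D' *\<^sub>v \<delta> \<in> carrier_vec K" "\<rho> \<in> carrier_vec K"
    using D D' x \<delta> b by (auto simp: \<rho>_def)
  note distr = scalar_prod_minus_distrib[of _ K] minus_scalar_prod_distrib[of _ K]
  let ?p = "vec_norm2 (D *\<^sub>v \<delta>)" and ?q = "vec_norm2 \<delta>"
  let ?s = "vec_norm2 x'" and ?t = "vec_norm2 \<rho>"
  have "(D *\<^sub>v \<delta>) \<bullet> (b - D *\<^sub>v x) = (\<Sum>i<d. \<gamma> i * (\<delta> $ i * x $ i))"
    and "(D' *\<^sub>v \<delta>) \<bullet> \<rho> = (\<Sum>i<d. \<gamma> i * (\<delta> $ i * x' $ i))"
    using sol sol' D D' \<delta> by (auto simp: ridge_solution_def \<rho>_def)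
  then have "(\<Sum>i<d. \<gamma> i * (\<delta> $ i * \<delta> $ i)) = (D' *\<^sub>v \<delta>) \<bullet> \<rho> - (D *\<^sub>v \<delta>) \<bullet> (b - D *\<^sub>v x)"
    using x by (auto simp: \<delta>_def algebra_simps simp flip: sum_subtractf intro!: sum.cong)
  moreover have "b - D *\<^sub>v x = \<rho> + (D' *\<^sub>v x' - D *\<^sub>v x') + D *\<^sub>v \<delta>"
    unfolding \<delta>_def mult_minus_distrib_mat_vec[OF D x(2,1)] \<rho>_def
    using D D' b c by (intro eq_vecI) auto
  ultimately have energy: "(\<Sum>i<d. \<gamma> i * (\<delta> $ i * \<delta> $ i)) + ?p\<^sup>2
      = (D' *\<^sub>v \<delta> - D *\<^sub>v \<delta>) \<bullet> \<rho> - (D *\<^sub>v \<delta>) \<bullet> (D' *\<^sub>v x' - D *\<^sub>v x')"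
    unfolding vec_norm2_square using c
    by (simp add: distr scalar_prod_add_distrib[of _ K])
  have "(D' *\<^sub>v \<delta> - D *\<^sub>v \<delta>) \<bullet> \<rho> \<le> vec_norm2 (D' *\<^sub>v \<delta> - D *\<^sub>v \<delta>) * ?t"
    using c by (intro scalar_prod_Cauchy_Schwarz) auto
  also have "\<dots> \<le> N * ?q * ?t" by (intro mult_right_mono N \<delta>) simp
  finally have e1: "(D' *\<^sub>v \<delta> - D *\<^sub>v \<delta>) \<bullet> \<rho> \<le> N * ?q * ?t" .
  have "- ((D *\<^sub>v \<delta>) \<bullet> (D' *\<^sub>v x' - D *\<^sub>v x')) = (D *\<^sub>v \<delta>) \<bullet> (D *\<^sub>v x' - D' *\<^sub>v x')"
    using c by (simp add: distr)
  also have "\<dots> \<le> ?p * vec_norm2 (D *\<^sub>v x' - D' *\<^sub>v x')"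
    using c by (intro scalar_prod_Cauchy_Schwarz) auto
  also have "\<dots> \<le> ?p * (N * ?s)"
    using N[OF x(2)] vec_norm2_minus_commute[OF c(2,3)] by (intro mult_left_mono) auto
  finally have e2: "- ((D *\<^sub>v \<delta>) \<bullet> (D' *\<^sub>v x' - D *\<^sub>v x')) \<le> N * (?p * ?s)" by (simp add: ac_simps)
  define a where "a = sqrt g"
  have a: "0 < a" "a * a = g" using \<open>0 < g\<close> by (auto simp: a_def)
  define L where "L = sqrt (?p\<^sup>2 + (a * ?q)\<^sup>2)"
  let ?B = "vec_norm2 b"
  have L0: "0 \<le> L" by (simp add: L_def)
  have L1: "L\<^sup>2 = ?p\<^sup>2 + g * ?q\<^sup>2"
    using \<open>0 < g\<close> by (simp add: L_def power_mult_distrib power2_eq_square[of a] a(2))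
  have L2: "?p\<^sup>2 + g * ?q\<^sup>2 \<le> N * (?q * ?t + ?p * ?s)"
    using energy e1 e2 ridge_weight_lower[OF \<delta>, of g \<gamma>, OF g] by (simp add: algebra_simps)
  have L3: "?q * ?t + ?p * ?s \<le> L * (?B / a)"
  proof -
    have "(?p * (a * ?s) + (a * ?q) * ?t)\<^sup>2 \<le> (?p\<^sup>2 + (a * ?q)\<^sup>2) * ((a * ?s)\<^sup>2 + ?t\<^sup>2)"
      using zero_le_power2[of "?p * ?t - (a * ?q) * (a * ?s)"]
      by (simp add: power2_eq_square algebra_simps)
    also have "\<dots> \<le> (?p\<^sup>2 + (a * ?q)\<^sup>2) * ?B\<^sup>2"
    proof (rule mult_left_mono)
      show "(a * ?s)\<^sup>2 + ?t\<^sup>2 \<le> ?B\<^sup>2"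
        using ridge_energy[OF D' b g _ sol'] \<open>0 < g\<close> a(2)
        by (simp add: \<rho>_def power_mult_distrib power2_eq_square[of a])
    qed simp
    finally have "?p * (a * ?s) + (a * ?q) * ?t \<le> sqrt ((?p\<^sup>2 + (a * ?q)\<^sup>2) * ?B\<^sup>2)"
      by (rule real_le_rsqrt)
    also have "\<dots> = L * ?B" by (simp add: real_sqrt_mult L_def)
    finally have "(?q * ?t + ?p * ?s) * a \<le> L * ?B" by (simp add: algebra_simps)
    then show ?thesis using a(1) by (simp add: pos_le_divide_eq)
  qed
  have LL: "L * L \<le> (N * (?B / a)) * L"
  proof -
    have "L * L \<le> N * (?q * ?t + ?p * ?s)" using L1 L2 by (simp add: power2_eq_square[of L])
    also have "\<dots> \<le> N * (L * (?B / a))" by (rule mult_left_mono[OF L3 \<open>0 \<le> N\<close>])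
    finally show ?thesis by (simp add: ac_simps)
  qed
  have "L \<le> N * (?B / a)"
  proof (cases "L = 0")
    case True
    have "0 \<le> N * (?B / a)" using a(1) \<open>0 \<le> N\<close> by simp
    then show ?thesis by (simp only: True)
  next
    case False
    with L0 have "0 < L" by linarith
    with LL show ?thesis by (rule mult_right_le_imp_le)
  qed
  moreover have "a * ?q \<le> L" unfolding L_def by (rule real_le_rsqrt) simp
  ultimately have "a * ?q \<le> N * (?B / a)" by linarith
  then have "?q \<le> N * (?B / a) / a" using a(1) by (simp only: pos_le_divide_eq mult.commute)
  also have "\<dots> = N / g * ?B" by (simp flip: a(2))
  finally have "?q \<le> N / g * ?B" .
  then show ?thesis using vec_norm2_minus_commute[OF x] by (simp add: \<delta>_def)
qed

lemma col_minus:
  fixes A B :: "real mat"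
  assumes "A \<in> carrier_mat p s" "B \<in> carrier_mat p s" "j < s"
  shows "col (A - B) j = col A j - col B j"
  by (rule eq_vecI) (use assms in auto)

text \<open>
  Pass from \<open>(D, R)\<close> to \<open>(D, R')\<close>, where linearity in the right-hand side applies, and from there
  to \<open>(D', R')\<close>, where only the data matrix changes. Both steps are estimated column by column.
\<close>

proposition ridge_operator_perturbation:
  assumes D: "D \<in> carrier_mat K d" and D': "D' \<in> carrier_mat K d"
    and R: "R \<in> carrier_mat K s" and R': "R' \<in> carrier_mat K s"
    and g: "\<And>i. i < d \<Longrightarrow> g \<le> \<gamma> i" and "0 < g"
  defines "\<Gamma> \<equiv> mat_diag d (\<lambda>i. sqrt (\<gamma> i))"
  shows "frobenius_norm (pinv (D @\<^sub>r \<Gamma>) * (R @\<^sub>r 0\<^sub>m d s) - pinv (D' @\<^sub>r \<Gamma>) * (R' @\<^sub>r 0\<^sub>m d s))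
    \<le> 1 / sqrt g * frobenius_norm (R - R')
      + spectral_norm (D' - D) / g * frobenius_norm R'"
proof -
  \<comment> \<open>The intermediate solution \<open>Y\<close> has the old data matrix and the new right-hand side.\<close>
  define O1 where "O1 = pinv (D @\<^sub>r \<Gamma>) * (R @\<^sub>r 0\<^sub>m d s)"
  define Y where "Y = pinv (D @\<^sub>r \<Gamma>) * (R' @\<^sub>r 0\<^sub>m d s)"
  define O2 where "O2 = pinv (D' @\<^sub>r \<Gamma>) * (R' @\<^sub>r 0\<^sub>m d s)"
  have \<gamma>: "0 < \<gamma> i" if "i < d" for i using g[OF that] \<open>0 < g\<close> by linarith
  have pinv_carrier: "pinv (D @\<^sub>r \<Gamma>) \<in> carrier_mat d (K + d)" if "D \<in> carrier_mat K d" for D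
    unfolding \<Gamma>_def by (rule pinv_regularized_carrier[of D K d \<gamma>, OF that \<gamma>])
  have c: "O1 \<in> carrier_mat d s" "Y \<in> carrier_mat d s" "O2 \<in> carrier_mat d s"
    unfolding O1_def Y_def O2_def
    by (rule mult_carrier_mat[OF pinv_carrier[OF D] carrier_append_rows[OF R zero_carrier_mat]]
        mult_carrier_mat[OF pinv_carrier[OF D] carrier_append_rows[OF R' zero_carrier_mat]]
        mult_carrier_mat[OF pinv_carrier[OF D'] carrier_append_rows[OF R' zero_carrier_mat]])+
  have sol: "ridge_solution D \<gamma> (col R j) (col O1 j)" "ridge_solution D \<gamma> (col R' j) (col Y j)"
    "ridge_solution D' \<gamma> (col R' j) (col O2 j)" if "j < s" for j
    unfolding O1_def Y_def O2_def \<Gamma>_def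
    by (rule ridge_solution_pinv[of D K d \<gamma>, OF D \<gamma> R that]
        ridge_solution_pinv[of D K d \<gamma>, OF D \<gamma> R' that]
        ridge_solution_pinv[of D' K d \<gamma>, OF D' \<gamma> R' that]; assumption)+
  have "frobenius_norm (O1 - Y) \<le> 1 / sqrt g * frobenius_norm (R - R')"
  proof (rule frobenius_norm_le_by_cols)
    fix j assume "j < dim_col (R - R')"
    then have j: "j < s" using R' by simp
    have b: "col R j \<in> carrier_vec K" "col R' j \<in> carrier_vec K"
      by (rule col_carrier_vec[OF j R] col_carrier_vec[OF j R'])+
    have cols: "col (O1 - Y) j = col O1 j - col Y j" "col (R - R') j = col R j - col R' j"
      by (rule col_minus[OF c(1,2) j] col_minus[OF R R' j])+
    show "vec_norm2 (col (O1 - Y) j) \<le> 1 / sqrt g * vec_norm2 (col (R - R') j)"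
      unfolding cols
      by (rule ridge_solution_bound[of D K d _ g \<gamma>, OF D minus_carrier_vec[OF b] g \<open>0 < g\<close>
            ridge_solution_minus[OF D b sol(1,2)[OF j]]])
  qed (use c R R' \<open>0 < g\<close> in auto)
  moreover have "frobenius_norm (Y - O2) \<le> spectral_norm (D' - D) / g * frobenius_norm R'"
  proof (rule frobenius_norm_le_by_cols)
    fix j assume "j < dim_col R'"
    then have j: "j < s" using R' by simp
    have b: "col R' j \<in> carrier_vec K" by (rule col_carrier_vec[OF j R'])
    have N: "vec_norm2 (D' *\<^sub>v v - D *\<^sub>v v) \<le> spectral_norm (D' - D) * vec_norm2 v"
      if v: "v \<in> carrier_vec d" for v
    proof -
      have "v \<in> carrier_vec (dim_col (D' - D))" using v D by simp
      then have "vec_norm2 ((D' - D) *\<^sub>v v) \<le> spectral_norm (D' - D) * vec_norm2 v"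
        by (rule vec_norm2_mult_le_spectral)
      then show ?thesis unfolding minus_mult_distrib_mat_vec[OF D' D v] .
    qed
    have cols: "col (Y - O2) j = col Y j - col O2 j"
      by (rule col_minus[OF c(2,3) j])
    show "vec_norm2 (col (Y - O2) j) \<le> spectral_norm (D' - D) / g * vec_norm2 (col R' j)"
      unfolding cols
      by (rule ridge_data_perturbation[of D K d D' _ g \<gamma>, OF D D' b g \<open>0 < g\<close> sol(2,3)[OF j] N])
        simp_all
  qed (use c R' \<open>0 < g\<close> in auto)
  moreover have "frobenius_norm (O1 - O2) \<le> frobenius_norm (O1 - Y) + frobenius_norm (Y - O2)"
  proof -
    have "O1 - O2 = (O1 - Y) + (Y - O2)" using c by (intro eq_matI) auto
    then show ?thesis
      using frobenius_norm_triangle[OF minus_carrier_mat[OF c(2), of O1]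
          minus_carrier_mat[OF c(3), of Y]]
      by simp
  qed
  ultimately show ?thesis unfolding O1_def[symmetric] O2_def[symmetric] by linarith
qed

section \<open>Singular values under perturbation\<close>

lemma vec_norm2_orthonormal_cols:
  fixes Q :: "real mat"
  assumes "transpose_mat Q * Q = 1\<^sub>m q" "Q \<in> carrier_mat p q" "u \<in> carrier_vec q"
  shows "vec_norm2 (Q *\<^sub>v u) = vec_norm2 u"
proof -
  have Qu: "Q *\<^sub>v u \<in> carrier_vec p" using assms by simp
  have "(Q *\<^sub>v u) \<bullet> (Q *\<^sub>v u) = (transpose_mat Q *\<^sub>v (Q *\<^sub>v u)) \<bullet> u"
    using transpose_vec_mult_scalar[OF assms(2,3) Qu] by simp
  also have "transpose_mat Q *\<^sub>v (Q *\<^sub>v u) = (transpose_mat Q * Q) *\<^sub>v u"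
    by (rule assoc_mult_mat_vec[symmetric, of _ q p _ q]) (use assms in auto)
  also have "\<dots> = u" using assms by simp
  finally show ?thesis by (simp add: vec_norm2_def)
qed

text \<open>
  Dual to the isometry property: a map and its transpose have the same operator norm.
\<close>

lemma Bessel_inequality:
  fixes Q :: "real mat"
  assumes "transpose_mat Q * Q = 1\<^sub>m q" "Q \<in> carrier_mat p q" "v \<in> carrier_vec p"
  shows "vec_norm2 (transpose_mat Q *\<^sub>v v) \<le> vec_norm2 v"
  using vec_norm2_transpose_mult_le[of Q 1 v] vec_norm2_orthonormal_cols[OF assms(1,2)] assms
  by auto

text \<open>
  Bessel's inequality for the \<open>k\<close>-th standard basis vector. This bounds a snapshot of the reduced
  data by the largest singular value, although orthonormality is a property of the columns only.
\<close>

lemma orthonormal_cols_row_le_1: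
  fixes Q :: "real mat"
  assumes "transpose_mat Q * Q = 1\<^sub>m q" "Q \<in> carrier_mat p q" "k < p"
  shows "(\<Sum>j<q. (Q $$ (k, j))\<^sup>2) \<le> 1"
proof -
  have "transpose_mat Q *\<^sub>v unit_vec p k = row Q k"
    using assms by (intro eq_vecI) auto
  then have "vec_norm2 (row Q k) \<le> vec_norm2 (unit_vec p k)"
    using Bessel_inequality[OF assms(1,2), of "unit_vec p k"] by simp
  also have "\<dots> = 1" using assms by (simp add: vec_norm2_def)
  finally have "(vec_norm2 (row Q k))\<^sup>2 \<le> 1" by (simp add: power_le_one)
  then show ?thesis using assms by (simp add: vec_norm2_square_sum)
qed

lemma orthonormal_cols_col_eq_1:
  fixes Q :: "real mat"
  assumes "transpose_mat Q * Q = 1\<^sub>m q" "Q \<in> carrier_mat p q" "j < q"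
  shows "(\<Sum>k<p. (Q $$ (k, j))\<^sup>2) = 1"
proof -
  have "(vec_norm2 (col Q j))\<^sup>2 = (transpose_mat Q * Q) $$ (j, j)"
    using assms(2,3) by (simp add: vec_norm2_square)
  also have "\<dots> = 1" using assms by simp
  finally show ?thesis using assms by (simp add: vec_norm2_square_sum)
qed

lemma is_svdD:
  assumes "is_svd X V S W" "dim_col V = p" "dim_col W = q"
  shows "transpose_mat V * V = 1\<^sub>m p" "transpose_mat W * W = 1\<^sub>m q"
    "diagonal_mat S" "X = V * S * transpose_mat W"
proof -
  have "transpose_mat V * V = 1\<^sub>m (dim_col V)" "transpose_mat W * W = 1\<^sub>m (dim_col W)"
    "diagonal_mat S" "X = V * S * transpose_mat W"
    using assms(1) unfolding is_svd_def by blast+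
  then show "transpose_mat V * V = 1\<^sub>m p" "transpose_mat W * W = 1\<^sub>m q"
    "diagonal_mat S" "X = V * S * transpose_mat W"
    unfolding assms(2,3) by blast+
qed

lemma is_svd_carrier:
  assumes "is_svd X V S W" "X \<in> carrier_mat n K" "dim_col V = p" "dim_col W = q"
  shows "V \<in> carrier_mat n p" "W \<in> carrier_mat K q"
    "S \<in> carrier_mat p q"
proof -
  have "dim_row V = dim_row X" "dim_row W = dim_col X"
    and S: "S \<in> carrier_mat (dim_col V) (dim_col W)"
    using assms(1) unfolding is_svd_def by blast+
  then show "V \<in> carrier_mat n p" "W \<in> carrier_mat K q"
    "S \<in> carrier_mat p q"
    using assms(2-4) by (auto intro!: carrier_matI)
qed

lemma is_svd_singular_values:
  assumes "is_svd X V S W" "dim_col V = p" "dim_col W = q" "j < p" "j < q"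
  shows "0 \<le> S $$ (j, j)" and "i \<le> j \<Longrightarrow> S $$ (j, j) \<le> S $$ (i, i)"
proof -
  have "S \<in> carrier_mat (dim_col V) (dim_col W)"
    and nonneg: "\<forall>i < min (dim_row S) (dim_col S). 0 \<le> S $$ (i, i)"
    and mono: "\<forall>i j. i \<le> j \<longrightarrow> j < min (dim_row S) (dim_col S) \<longrightarrow> S $$ (j, j) \<le> S $$ (i, i)"
    using assms(1) unfolding is_svd_def by blast+
  then have "j < min (dim_row S) (dim_col S)" using assms by simp
  then show "0 \<le> S $$ (j, j)" and "i \<le> j \<Longrightarrow> S $$ (j, j) \<le> S $$ (i, i)"
    using nonneg mono by blast+
qed

lemma diagonal_mult_vec_norm:
  assumes S: "S \<in> carrier_mat p q" "diagonal_mat S" and c: "c \<in> carrier_vec q"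
  shows "(vec_norm2 (S *\<^sub>v c))\<^sup>2 = (\<Sum>i<min p q. (S $$ (i, i) * c $ i)\<^sup>2)"
proof -
  have nth: "(S *\<^sub>v c) $ i = (if i < q then S $$ (i, i) * c $ i else 0)" if "i < p" for i
  proof -
    have "(S *\<^sub>v c) $ i = (\<Sum>k<q. S $$ (i, k) * c $ k)"
      using S c that by (simp add: scalar_prod_def lessThan_atLeast0)
    also have "\<dots> = (\<Sum>k<q. if k = i then S $$ (i, i) * c $ i else 0)"
      using S that by (intro sum.cong) (auto simp: diagonal_mat_def)
    finally show ?thesis by simp
  qed
  have "(vec_norm2 (S *\<^sub>v c))\<^sup>2 = (\<Sum>i<p. (if i < q then S $$ (i, i) * c $ i else 0)\<^sup>2)"
    using S by (simp add: vec_norm2_square_sum nth del: index_mult_mat_vec)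
  also have "\<dots> = (\<Sum>i<min p q. (S $$ (i, i) * c $ i)\<^sup>2)"
    by (intro sum.mono_neutral_cong_right) auto
  finally show ?thesis .
qed

text \<open>
  \<open>V\<close> is an isometry, so only the diagonal factor acts on the coordinates \<open>W\<^sup>T v\<close>. The sum is over the
  length of the diagonal because \<open>S\<close> may be rectangular.
\<close>

lemma is_svd_mult_vec_norm:
  assumes svd: "is_svd X V S W" and dims: "dim_col V = p" "dim_col W = q"
    and X: "X \<in> carrier_mat n K" and v: "v \<in> carrier_vec K"
  shows "(vec_norm2 (X *\<^sub>v v))\<^sup>2
    = (\<Sum>i<min p q. (S $$ (i, i) * (transpose_mat W *\<^sub>v v) $ i)\<^sup>2)"
proof -
  note c = is_svd_carrier[OF svd X dims]
  define w where "w = transpose_mat W *\<^sub>v v"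
  have tW: "transpose_mat W \<in> carrier_mat q K" using c by simp
  have w: "w \<in> carrier_vec q" using tW v by (simp add: w_def)
  have VS: "V * S \<in> carrier_mat n q" using c by auto
  have Sw: "S *\<^sub>v w \<in> carrier_vec p" using c w by simp
  have "X *\<^sub>v v = V *\<^sub>v (S *\<^sub>v w)"
  proof -
    have "X *\<^sub>v v = (V * S * transpose_mat W) *\<^sub>v v"
      by (subst is_svdD(4)[OF svd dims]) (rule refl)
    also have "\<dots> = (V * S) *\<^sub>v w" unfolding w_def by (rule assoc_mult_mat_vec[OF VS tW v])
    also have "\<dots> = V *\<^sub>v (S *\<^sub>v w)" by (rule assoc_mult_mat_vec[OF c(1,3) w])
    finally show ?thesis .
  qed
  then have "vec_norm2 (X *\<^sub>v v) = vec_norm2 (S *\<^sub>v w)"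
    using vec_norm2_orthonormal_cols[OF is_svdD(1)[OF svd dims] c(1) Sw] by simp
  then show ?thesis
    using diagonal_mult_vec_norm[OF c(3) is_svdD(3)[OF svd dims] w] by (simp flip: w_def)
qed

text \<open>
  One half of the Courant-Fischer principle: away from the first \<open>j\<close> right singular vectors the
  matrix stretches by at most the singular value of index \<open>j\<close>.
\<close>

lemma is_svd_upper:
  assumes svd: "is_svd X V S W" and dims: "dim_col V = p" "dim_col W = q"
    and X: "X \<in> carrier_mat n K" and v: "v \<in> carrier_vec K"
    and j: "j < p" "j < q"
    and orth: "\<And>i. i < j \<Longrightarrow> (transpose_mat W *\<^sub>v v) $ i = 0"
  shows "vec_norm2 (X *\<^sub>v v) \<le> S $$ (j, j) * vec_norm2 v"
proof -
  note c = is_svd_carrier[OF svd X dims] and sv = is_svd_singular_values[OF svd dims]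
  let ?w = "transpose_mat W *\<^sub>v v" and ?m = "min p q"
  have "(vec_norm2 (X *\<^sub>v v))\<^sup>2 = (\<Sum>i<?m. (S $$ (i, i) * ?w $ i)\<^sup>2)"
    by (rule is_svd_mult_vec_norm[OF svd dims X v])
  also have "\<dots> \<le> (\<Sum>i<?m. (S $$ (j, j) * ?w $ i)\<^sup>2)"
  proof (rule sum_mono)
    fix i assume i: "i \<in> {..<?m}"
    show "(S $$ (i, i) * ?w $ i)\<^sup>2 \<le> (S $$ (j, j) * ?w $ i)\<^sup>2"
    proof (cases "i < j")
      case False
      then have "S $$ (i, i) \<le> S $$ (j, j)" "0 \<le> S $$ (i, i)" using sv i by auto
      then show ?thesis by (auto simp: power_mult_distrib intro!: mult_right_mono power_mono)
    qed (use orth in simp)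
  qed
  also have "\<dots> \<le> (\<Sum>i<q. (S $$ (j, j) * ?w $ i)\<^sup>2)"
    by (intro sum_mono2) auto
  also have "\<dots> = (S $$ (j, j) * vec_norm2 ?w)\<^sup>2"
    using c by (simp add: power_mult_distrib vec_norm2_square_sum sum_distrib_left
        del: index_mult_mat_vec)
  finally have "vec_norm2 (X *\<^sub>v v) \<le> S $$ (j, j) * vec_norm2 ?w"
    by (rule power2_le_imp_le) (use sv j in simp)
  also have "\<dots> \<le> S $$ (j, j) * vec_norm2 v"
    using Bessel_inequality[OF is_svdD(2)[OF svd dims] c(2) v] sv(1)[OF j] by (rule mult_left_mono)
  finally show ?thesis .
qed

text \<open>
  The other half: on the span of the right singular vectors of index up to \<open>j\<close> the matrix stretches
  by at least the singular value of index \<open>j\<close>.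
\<close>

lemma is_svd_lower:
  assumes svd: "is_svd X V S W" and dims: "dim_col V = p" "dim_col W = q"
    and X: "X \<in> carrier_mat n K" and u: "u \<in> carrier_vec q"
    and j: "j < p" "j < q"
    and supp: "\<And>i. j < i \<Longrightarrow> i < q \<Longrightarrow> u $ i = 0"
  shows "S $$ (j, j) * vec_norm2 u \<le> vec_norm2 (X *\<^sub>v (W *\<^sub>v u))"
proof -
  note c = is_svd_carrier[OF svd X dims] and sv = is_svd_singular_values[OF svd dims]
  let ?m = "min p q"
  have "transpose_mat W *\<^sub>v (W *\<^sub>v u) = (transpose_mat W * W) *\<^sub>v u"
    by (rule assoc_mult_mat_vec[symmetric, of _ q K _ q]) (use c u in auto)
  then have wu: "transpose_mat W *\<^sub>v (W *\<^sub>v u) = u" using is_svdD(2)[OF svd dims] u by simp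
  have Wu: "W *\<^sub>v u \<in> carrier_vec K" using c u by simp
  have "(S $$ (j, j) * vec_norm2 u)\<^sup>2 = (\<Sum>i<q. (S $$ (j, j) * u $ i)\<^sup>2)"
    using u by (simp add: power_mult_distrib vec_norm2_square_sum sum_distrib_left)
  also have "\<dots> = (\<Sum>i<?m. (S $$ (j, j) * u $ i)\<^sup>2)"
    using j supp by (intro sum.mono_neutral_right) auto
  also have "\<dots> \<le> (\<Sum>i<?m. (S $$ (i, i) * u $ i)\<^sup>2)"
  proof (rule sum_mono)
    fix i assume i: "i \<in> {..<?m}"
    show "(S $$ (j, j) * u $ i)\<^sup>2 \<le> (S $$ (i, i) * u $ i)\<^sup>2"
    proof (cases "j < i")
      case False
      then have "S $$ (j, j) \<le> S $$ (i, i)" "0 \<le> S $$ (j, j)" using sv j by auto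
      then show ?thesis by (auto simp: power_mult_distrib intro!: mult_right_mono power_mono)
    qed (use supp i in simp)
  qed
  also have "\<dots> = (vec_norm2 (X *\<^sub>v (W *\<^sub>v u)))\<^sup>2"
    using is_svd_mult_vec_norm[OF svd dims X Wu] unfolding wu by simp
  finally show ?thesis by (rule power2_le_imp_le) simp
qed

text \<open>
  There are \<open>j\<close> linear conditions on \<open>j + 1\<close> free coordinates.
\<close>

lemma exists_kernel_vector_supported:
  fixes N :: "real mat"
  assumes N: "N \<in> carrier_mat p q" and j: "j < p" "j < q"
  obtains u where "u \<in> carrier_vec q" "u \<noteq> 0\<^sub>v q"
    "\<And>i. j < i \<Longrightarrow> i < q \<Longrightarrow> u $ i = 0" "\<And>i. i < j \<Longrightarrow> (N *\<^sub>v u) $ i = 0"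
proof -
  \<comment> \<open>A zero row is added so that the singular square matrix supplies the kernel vector.\<close>
  define M where "M = mat (Suc j) (Suc j) (\<lambda>(i, k). if i < j then N $$ (i, k) else 0)"
  have M: "M \<in> carrier_mat (Suc j) (Suc j)" by (simp add: M_def)
  have tM: "transpose_mat M \<in> carrier_mat (Suc j) (Suc j)" using M by simp
  have "transpose_mat M *\<^sub>v unit_vec (Suc j) j = 0\<^sub>v (Suc j)"
    by (intro eq_vecI) (auto simp: M_def)
  moreover have "unit_vec (Suc j) j \<noteq> (0\<^sub>v (Suc j) :: real vec)"
    by (rule unit_vec_nonzero) simp
  ultimately have "det (transpose_mat M) = 0"
    using unit_vec_carrier[of "Suc j" j] unfolding det_0_iff_vec_prod_zero[OF tM] by blast
  then obtain x where x: "x \<in> carrier_vec (Suc j)" "x \<noteq> 0\<^sub>v (Suc j)" "M *\<^sub>v x = 0\<^sub>v (Suc j)"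
    using det_0_iff_vec_prod_zero[OF M] det_transpose[OF M] by auto
  define u where "u = vec q (\<lambda>i. if i \<le> j then x $ i else 0)"
  show ?thesis
  proof (rule that)
    show "u \<in> carrier_vec q" by (simp add: u_def)
    show "u \<noteq> 0\<^sub>v q"
    proof
      assume u0: "u = 0\<^sub>v q"
      have "x = 0\<^sub>v (Suc j)"
      proof (rule eq_vecI)
        fix i assume "i < dim_vec (0\<^sub>v (Suc j) :: real vec)"
        then have i: "i \<le> j" "i < q" using j by auto
        then have "x $ i = u $ i" by (simp add: u_def)
        then show "x $ i = 0\<^sub>v (Suc j) $ i" using i u0 by simp
      qed (use x in simp)
      then show False using x by simp
    qed
    show "u $ i = 0" if "j < i" "i < q" for i using that by (simp add: u_def)
    show "(N *\<^sub>v u) $ i = 0" if i: "i < j" for i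
    proof -
      have "(N *\<^sub>v u) $ i = (\<Sum>k<q. N $$ (i, k) * (if k \<le> j then x $ k else 0))"
        using N i j by (auto simp: scalar_prod_def lessThan_atLeast0 u_def intro!: sum.cong)
      also have "\<dots> = (\<Sum>k<Suc j. M $$ (i, k) * x $ k)"
        using i j by (intro sum.mono_neutral_cong_right) (auto simp: M_def)
      also have "\<dots> = (M *\<^sub>v x) $ i"
        using i M x(1) by (auto simp: scalar_prod_def lessThan_atLeast0 intro!: sum.cong)
      also have "\<dots> = 0" using i by (simp add: x)
      finally show ?thesis .
    qed
  qed
qed

text \<open>
  Weyl's argument: by counting dimensions, the span of the first \<open>j + 1\<close> right singular vectors of \<open>X\<close>
  contains a nonzero vector orthogonal to the first \<open>j\<close> right singular vectors of \<open>X'\<close>. On this vector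
  \<open>X\<close> stretches by at least its singular value and \<open>X'\<close> by at most its own.
\<close>

lemma singular_value_le:
  assumes svd: "is_svd X V S W" and svd': "is_svd X' V' S' W'"
    and dims: "dim_col V = p" "dim_col W = q" and dims': "dim_col V' = p'" "dim_col W' = q'"
    and X: "X \<in> carrier_mat n K" and X': "X' \<in> carrier_mat n K"
    and j: "j < p" "j < q" "j < p'" "j < q'"
    and N: "\<And>v. v \<in> carrier_vec K \<Longrightarrow> vec_norm2 (X *\<^sub>v v - X' *\<^sub>v v) \<le> e * vec_norm2 v"
  shows "S $$ (j, j) \<le> S' $$ (j, j) + e"
proof -
  note c = is_svd_carrier[OF svd X dims] is_svd_carrier[OF svd' X' dims']
  have C: "transpose_mat W' * W \<in> carrier_mat q' q" using c by auto
  obtain u where u: "u \<in> carrier_vec q" "u \<noteq> 0\<^sub>v q"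
    and supp: "\<And>i. j < i \<Longrightarrow> i < q \<Longrightarrow> u $ i = 0"
    and ker: "\<And>i. i < j \<Longrightarrow> ((transpose_mat W' * W) *\<^sub>v u) $ i = 0"
    using exists_kernel_vector_supported[OF C j(4,2)] by metis
  define v where "v = W *\<^sub>v u"
  have v: "v \<in> carrier_vec K" using c u by (simp add: v_def)
  have Xv: "X *\<^sub>v v \<in> carrier_vec n" "X' *\<^sub>v v \<in> carrier_vec n" using X X' v by auto
  have "vec_norm2 v = vec_norm2 u"
    unfolding v_def using vec_norm2_orthonormal_cols[OF is_svdD(2)[OF svd dims] c(2) u(1)] .
  have "vec_norm2 u \<noteq> 0" using vec_norm2_eq_0D[OF u(1)] u(2) by blast
  then have pos: "0 < vec_norm2 u" by (simp add: less_le)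
  have "(transpose_mat W' * W) *\<^sub>v u = transpose_mat W' *\<^sub>v v"
    unfolding v_def by (rule assoc_mult_mat_vec[of _ q' K _ q]) (use c u in auto)
  then have upper: "vec_norm2 (X' *\<^sub>v v) \<le> S' $$ (j, j) * vec_norm2 v"
    using ker by (intro is_svd_upper[OF svd' dims' X' v j(3,4)]) simp
  have "S $$ (j, j) * vec_norm2 u \<le> vec_norm2 (X *\<^sub>v v)"
    unfolding v_def by (rule is_svd_lower[OF svd dims X u(1) j(1,2) supp])
  also have "X *\<^sub>v v = (X *\<^sub>v v - X' *\<^sub>v v) + X' *\<^sub>v v"
    using X X' v by (intro eq_vecI) auto
  also have "vec_norm2 \<dots> \<le> vec_norm2 (X *\<^sub>v v - X' *\<^sub>v v) + vec_norm2 (X' *\<^sub>v v)"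
    using Xv by (intro vec_norm2_triangle) auto
  also have "\<dots> \<le> (S' $$ (j, j) + e) * vec_norm2 u"
    using N[OF v] upper \<open>vec_norm2 v = vec_norm2 u\<close> by (simp add: algebra_simps)
  finally show ?thesis using pos by simp
qed

proposition Weyl_singular_value_perturbation:
  assumes svd: "is_svd X V S W" and svd': "is_svd X' V' S' W'"
    and dims: "dim_col V = p" "dim_col W = q" and dims': "dim_col V' = p'" "dim_col W' = q'"
    and X: "X \<in> carrier_mat n K" and X': "X' \<in> carrier_mat n K"
    and j: "j < p" "j < q" "j < p'" "j < q'"
  shows "\<bar>S $$ (j, j) - S' $$ (j, j)\<bar> \<le> spectral_norm (X - X')"
proof -
  have N: "vec_norm2 (X *\<^sub>v v - X' *\<^sub>v v) \<le> spectral_norm (X - X') * vec_norm2 v"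
    if v: "v \<in> carrier_vec K" for v
    using vec_norm2_mult_le_spectral[of v "X - X'"] X X' v
    by (simp add: minus_mult_distrib_mat_vec[OF X X' v])
  then have N': "vec_norm2 (X' *\<^sub>v v - X *\<^sub>v v) \<le> spectral_norm (X - X') * vec_norm2 v"
    if v: "v \<in> carrier_vec K" for v
    using vec_norm2_minus_commute[of "X *\<^sub>v v" n "X' *\<^sub>v v"] N[OF v] X X' v by auto
  show ?thesis
    using singular_value_le[OF svd svd' dims dims' X X' j N]
      singular_value_le[OF svd' svd dims' dims X' X j(3,4,1,2) N'] by linarith
qed

section \<open>Perturbation of the reduced data\<close>

lemma frobenius_norm_mat_diag_mult_le:
  assumes M: "M \<in> carrier_mat r K" and s: "\<And>i. i < r \<Longrightarrow> \<bar>s i\<bar> \<le> c" and "0 \<le> c"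
  shows "frobenius_norm (mat_diag r s * M) \<le> c * frobenius_norm M"
proof -
  have "frobenius_norm (mat_diag r s * M) = L2_set (\<lambda>(i, k). \<bar>s i * M $$ (i, k)\<bar>) ({..<r} \<times> {..<K})"
    unfolding mat_diag_mult_left[OF M] frobenius_norm_conv_L2_set L2_set_def
    by (auto intro!: sum.cong)
  also have "\<dots> \<le> L2_set (\<lambda>(i, k). c * \<bar>M $$ (i, k)\<bar>) ({..<r} \<times> {..<K})"
    using s by (intro L2_set_mono) (auto simp: abs_mult intro!: mult_right_mono)
  also have "\<dots> = L2_set (\<lambda>ik. c * \<bar>M $$ ik\<bar>) ({..<r} \<times> {..<K})"
    by (intro L2_set_cong) auto
  also have "\<dots> = c * frobenius_norm M"
    using M \<open>0 \<le> c\<close> unfolding L2_set_right_distrib[OF \<open>0 \<le> c\<close>, symmetric]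
    by (simp add: frobenius_norm_conv_L2_set L2_set_def)
  finally show ?thesis .
qed

text \<open>
  Split \<open>\<Sigma>' W'\<^sup>T - \<Sigma> W\<^sup>T = \<Sigma> (W' - W)\<^sup>T + (\<Sigma>' - \<Sigma>) W'\<^sup>T\<close>. Keeping the exact \<open>\<Sigma>\<close> in front of the
  vector error puts \<open>\<sigma>\<close>, and not \<open>\<sigma> + \<epsilon>\<close>, into the first term.
\<close>

lemma reduced_data_perturbation:
  assumes W: "W \<in> carrier_mat K r" and W': "W' \<in> carrier_mat K r"
    and s: "\<And>i. i < r \<Longrightarrow> \<bar>s i\<bar> \<le> \<sigma>" and ss': "\<And>i. i < r \<Longrightarrow> \<bar>s i - s' i\<bar> \<le> \<epsilon>"
    and "0 \<le> \<sigma>" "0 \<le> \<epsilon>"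
  shows "frobenius_norm (mat_diag r s' * transpose_mat W' - mat_diag r s * transpose_mat W)
    \<le> \<sigma> * frobenius_norm (W - W') + \<epsilon> * frobenius_norm W'"
proof -
  let ?A = "mat_diag r s * transpose_mat (W' - W)"
  let ?B = "mat_diag r (\<lambda>i. s' i - s i) * transpose_mat W'"
  have t: "transpose_mat W \<in> carrier_mat r K" "transpose_mat W' \<in> carrier_mat r K"
    "transpose_mat (W' - W) \<in> carrier_mat r K" using W W' by auto
  have "mat_diag r s' * transpose_mat W' - mat_diag r s * transpose_mat W = ?A + ?B"
    unfolding mat_diag_mult_left[OF t(1)] mat_diag_mult_left[OF t(2)] mat_diag_mult_left[OF t(3)]
    using W W' by (intro eq_matI) (simp_all add: right_diff_distrib left_diff_distrib)
  also have "frobenius_norm \<dots> \<le> frobenius_norm ?A + frobenius_norm ?B"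
    by (rule frobenius_norm_triangle[OF mult_carrier_mat[OF mat_diag_dim t(3)]
          mult_carrier_mat[OF mat_diag_dim t(2)]])
  also have "frobenius_norm ?A \<le> \<sigma> * frobenius_norm (transpose_mat (W' - W))"
    by (rule frobenius_norm_mat_diag_mult_le[OF t(3) s \<open>0 \<le> \<sigma>\<close>])
  also have "frobenius_norm (transpose_mat (W' - W)) = frobenius_norm (W - W')"
    unfolding frobenius_norm_transpose by (rule frobenius_norm_minus_commute[OF W' W])
  also have "frobenius_norm ?B \<le> \<epsilon> * frobenius_norm (transpose_mat W')"
    using ss' by (intro frobenius_norm_mat_diag_mult_le[OF t(2) _ \<open>0 \<le> \<epsilon>\<close>]) (simp add: abs_minus_commute)
  finally show ?thesis by (simp add: frobenius_norm_transpose)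
qed

lemma leading_cols_carrier: "A \<in> carrier_mat p q \<Longrightarrow> leading_cols r A \<in> carrier_mat p r"
  by (simp add: leading_cols_def)

lemma frobenius_norm_leading_cols:
  assumes "transpose_mat Q * Q = 1\<^sub>m q" "Q \<in> carrier_mat p q" "r \<le> q"
  shows "frobenius_norm (leading_cols r Q) = sqrt (real r)"
proof -
  have "(\<Sum>i<p. \<Sum>j<r. (leading_cols r Q $$ (i, j))\<^sup>2) = (\<Sum>j<r. \<Sum>i<p. (Q $$ (i, j))\<^sup>2)"
    using assms by (subst sum.swap) (auto simp: leading_cols_def intro!: sum.cong)
  also have "\<dots> = real r" using orthonormal_cols_col_eq_1[OF assms(1,2)] assms(3) by simp
  finally show ?thesis using assms by (simp add: frobenius_norm_def leading_cols_def)
qed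

lemma vec_norm2_col_reduced_data_le:
  assumes Q: "transpose_mat Q * Q = 1\<^sub>m q" "Q \<in> carrier_mat K q" and r: "r \<le> q" and k: "k < K"
    and s: "\<And>i. i < r \<Longrightarrow> \<bar>s i\<bar> \<le> c" and "0 \<le> c"
  shows "vec_norm2 (col (mat_diag r s * transpose_mat (leading_cols r Q)) k) \<le> c"
proof (rule power2_le_imp_le)
  have t: "transpose_mat (leading_cols r Q) \<in> carrier_mat r K"
    using leading_cols_carrier[OF Q(2)] by simp
  have "(vec_norm2 (col (mat_diag r s * transpose_mat (leading_cols r Q)) k))\<^sup>2
      = (\<Sum>i<r. (s i)\<^sup>2 * (Q $$ (k, i))\<^sup>2)"
    unfolding mat_diag_mult_left[OF t] vec_norm2_square_sum
    using Q k by (auto simp: leading_cols_def power_mult_distrib intro!: sum.cong)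
  also have "\<dots> \<le> (\<Sum>i<r. c\<^sup>2 * (Q $$ (k, i))\<^sup>2)"
    using s by (intro sum_mono mult_right_mono)
      (auto intro: power2_le_iff_abs_le[THEN iffD2, OF \<open>0 \<le> c\<close>])
  also have "\<dots> = c\<^sup>2 * (\<Sum>i<r. (Q $$ (k, i))\<^sup>2)" by (simp add: sum_distrib_left)
  also have "\<dots> \<le> c\<^sup>2 * (\<Sum>i<q. (Q $$ (k, i))\<^sup>2)"
    using r by (intro mult_left_mono sum_mono2) auto
  also have "\<dots> \<le> c\<^sup>2 * 1"
    using orthonormal_cols_row_le_1[OF Q k] by (intro mult_left_mono) auto
  finally show "(vec_norm2 (col (mat_diag r s * transpose_mat (leading_cols r Q)) k))\<^sup>2 \<le> c\<^sup>2" by simp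
qed fact

section \<open>Perturbation of Kronecker squares and of the data matrix\<close>

lemma sum_div_mod:
  fixes h :: "nat \<Rightarrow> nat \<Rightarrow> real"
  shows "(\<Sum>i<p * q. h (i div q) (i mod q)) = (\<Sum>(a, b)\<in>{..<p} \<times> {..<q}. h a b)"
proof (rule sum.reindex_bij_witness[of _ "\<lambda>(a, b). a * q + b" "\<lambda>i. (i div q, i mod q)"])
  fix i assume "i \<in> {..<p * q}"
  then have i: "i < p * q" by simp
  then have "0 < q" by (cases q) auto
  then show "(i div q, i mod q) \<in> {..<p} \<times> {..<q}"
    using i by (auto simp: less_mult_imp_div_less)
  show "(case (i div q, i mod q) of (a, b) \<Rightarrow> a * q + b) = i" by simp
next
  fix ab assume "ab \<in> {..<p} \<times> {..<q}"
  then obtain a b where ab: "ab = (a, b)" "a < p" "b < q" by auto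
  have "a * q + b < Suc a * q" using ab by simp
  also have "\<dots> \<le> p * q" using ab by (intro mult_le_mono1) simp
  finally show "(case ab of (a, b) \<Rightarrow> a * q + b) \<in> {..<p * q}" using ab by simp
  show "((case ab of (a, b) \<Rightarrow> a * q + b) div q, (case ab of (a, b) \<Rightarrow> a * q + b) mod q) = ab"
    using ab by simp
qed auto

lemma sum_lessThan_add: "(\<Sum>j<a + b. f j) = (\<Sum>j<a. f j) + (\<Sum>i<b. f (a + i :: nat))"
  for f :: "nat \<Rightarrow> real"
  by (induction b) auto

lemma L2_set_product:
  "L2_set (\<lambda>(a, b). f a * g b) (A \<times> B) = L2_set f A * L2_set g B"
proof -
  have "(\<Sum>ab\<in>A \<times> B. (case ab of (a, b) \<Rightarrow> f a * g b)\<^sup>2) = (\<Sum>a\<in>A. (f a)\<^sup>2) * (\<Sum>b\<in>B. (g b)\<^sup>2)"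
    by (simp add: sum_product sum.cartesian_product power_mult_distrib case_prod_beta)
  then show ?thesis by (simp add: L2_set_def real_sqrt_mult)
qed

text \<open>
  From \<open>z' \<otimes> z' - z \<otimes> z = (z' - z) \<otimes> z' + z \<otimes> (z' - z)\<close> and the multiplicativity of the Euclidean norm
  on Kronecker products.
\<close>

lemma kronecker_square_perturbation:
  fixes z z' :: "nat \<Rightarrow> real"
  shows "L2_set (\<lambda>i. z' (i div r) * z' (i mod r) - z (i div r) * z (i mod r)) {..<r * r}
    \<le> L2_set (\<lambda>i. z' i - z i) {..<r} * (L2_set z' {..<r} + L2_set z {..<r})"
proof -
  let ?A = "{..<r} \<times> {..<r}" and ?f = "\<lambda>i. z' i - z i"
  have "L2_set (\<lambda>i. z' (i div r) * z' (i mod r) - z (i div r) * z (i mod r)) {..<r * r}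
      = L2_set (\<lambda>(a, b). z' a * z' b - z a * z b) ?A"
    unfolding L2_set_def
    using sum_div_mod[of "\<lambda>a b. (z' a * z' b - z a * z b)\<^sup>2" r r] by (simp add: case_prod_beta)
  also have "\<dots> = L2_set (\<lambda>ab. (\<lambda>(a, b). ?f a * z' b) ab + (\<lambda>(a, b). z a * ?f b) ab) ?A"
    by (intro L2_set_cong) (auto simp: algebra_simps)
  also have "\<dots> \<le> L2_set (\<lambda>(a, b). ?f a * z' b) ?A + L2_set (\<lambda>(a, b). z a * ?f b) ?A"
    by (rule L2_set_triangle_ineq)
  also have "\<dots> = L2_set ?f {..<r} * (L2_set z' {..<r} + L2_set z {..<r})"
    by (simp only: L2_set_product) (simp add: algebra_simps)
  finally show ?thesis .
qed

lemma append_rows_nth: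
  assumes "A \<in> carrier_mat p q" "B \<in> carrier_mat p' q" "i < p + p'" "j < q"
  shows "(A @\<^sub>r B) $$ (i, j) = (if i < p then A $$ (i, j) else B $$ (i - p, j))"
  using assms by (auto simp: append_rows_def)

lemma append_cols_carrier:
  "A \<in> carrier_mat p q \<Longrightarrow> B \<in> carrier_mat p q' \<Longrightarrow> A @\<^sub>c B \<in> carrier_mat p (q + q')"
  using carrier_append_rows[of "transpose_mat A" q p "transpose_mat B" q']
  by (simp add: append_cols_def)

lemma append_cols_nth:
  assumes "A \<in> carrier_mat p q" "B \<in> carrier_mat p q'" "i < p" "j < q + q'"
  shows "(A @\<^sub>c B) $$ (i, j) = (if j < q then A $$ (i, j) else B $$ (i, j - q))"
proof -
  have t: "transpose_mat A \<in> carrier_mat q p" "transpose_mat B \<in> carrier_mat q' p"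
    using assms by auto
  have C: "transpose_mat A @\<^sub>r transpose_mat B \<in> carrier_mat (q + q') p"
    by (rule carrier_append_rows[OF t])
  have "(A @\<^sub>c B) $$ (i, j) = (transpose_mat A @\<^sub>r transpose_mat B) $$ (j, i)"
    unfolding append_cols_def
    using assms(3,4) by (intro index_transpose_mat) (simp_all only: carrier_matD[OF C])
  also have "\<dots> = (if j < q then transpose_mat A $$ (j, i) else transpose_mat B $$ (j - q, i))"
    by (rule append_rows_nth[OF t assms(4,3)])
  also have "\<dots> = (if j < q then A $$ (i, j) else B $$ (i, j - q))"
    using assms by auto
  finally show ?thesis .
qed

lemma khatri_rao_carrier:
  "A \<in> carrier_mat p K \<Longrightarrow> B \<in> carrier_mat p' K \<Longrightarrow> A \<odot> B \<in> carrier_mat (p * p') K"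
  by (intro carrier_matI) (simp_all add: khatri_rao_def)

lemma khatri_rao_nth:
  assumes "A \<in> carrier_mat p K" "B \<in> carrier_mat p' K" "i < p * p'" "k < K"
  shows "(A \<odot> B) $$ (i, k) = A $$ (i div p', k) * B $$ (i mod p', k)"
proof -
  have "0 < p'" using assms by (cases p') auto
  then show ?thesis using assms
    by (simp add: khatri_rao_def mat_of_cols_index kron_vec_def less_mult_imp_div_less)
qed

lemma data_mat_carrier_nth:
  fixes Sr Wr U :: "real mat"
  defines "Z \<equiv> Sr * transpose_mat Wr"
  assumes Z: "Z \<in> carrier_mat r K" and U: "U \<in> carrier_mat m K" and "dim_row Wr = K"
  shows "data_mat Sr Wr U \<in> carrier_mat K (r + (r * r + (m + 1)))"
    and "k < K \<Longrightarrow> j < r + (r * r + (m + 1)) \<Longrightarrow> data_mat Sr Wr U $$ (k, j) =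
      (if j < r then Z $$ (j, k)
       else if j - r < r * r then Z $$ ((j - r) div r, k) * Z $$ ((j - r) mod r, k)
       else if j - r - r * r < m then U $$ (j - r - r * r, k) else 1)"
proof -
  let ?B = "transpose_mat (Z \<odot> Z)" and ?one = "mat K 1 (\<lambda>_. 1) :: real mat"
  have c: "transpose_mat Z \<in> carrier_mat K r" "?B \<in> carrier_mat K (r * r)"
    "transpose_mat U \<in> carrier_mat K m" "?one \<in> carrier_mat K 1"
    using Z U khatri_rao_carrier[OF Z Z] by auto
  note c3 = append_cols_carrier[OF c(3,4)]
  note c2 = append_cols_carrier[OF c(2) c3]
  have eq: "data_mat Sr Wr U = transpose_mat Z @\<^sub>c ?B @\<^sub>c transpose_mat U @\<^sub>c ?one"
    using assms by (simp add: data_mat_def Let_def)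
  show "data_mat Sr Wr U \<in> carrier_mat K (r + (r * r + (m + 1)))"
    unfolding eq by (rule append_cols_carrier[OF c(1) c2])
  assume k: "k < K" and j: "j < r + (r * r + (m + 1))"
  define X3 X2 where "X3 = transpose_mat U @\<^sub>c ?one" and "X2 = ?B @\<^sub>c X3"
  have n1: "data_mat Sr Wr U $$ (k, j)
      = (if j < r then transpose_mat Z $$ (k, j) else X2 $$ (k, j - r))"
    unfolding eq X2_def X3_def by (rule append_cols_nth[OF c(1) c2 k j])
  have n2: "X2 $$ (k, j - r)
      = (if j - r < r * r then ?B $$ (k, j - r) else X3 $$ (k, j - r - r * r))" if "\<not> j < r"
    unfolding X2_def X3_def by (rule append_cols_nth[OF c(2) c3 k]) (use j that in linarith)
  have n3: "X3 $$ (k, j - r - r * r) = (if j - r - r * r < m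
      then transpose_mat U $$ (k, j - r - r * r) else ?one $$ (k, j - r - r * r - m))"
    if "\<not> j < r" "\<not> j - r < r * r"
    unfolding X3_def by (rule append_cols_nth[OF c(3,4) k]) (use j that in linarith)
  have one: "?one $$ (k, j - r - r * r - m) = 1" using k j by (subst index_mat) auto
  have ZZ: "?B $$ (k, j - r) = Z $$ ((j - r) div r, k) * Z $$ ((j - r) mod r, k)" if "j - r < r * r"
    using khatri_rao_nth[OF Z Z that k] khatri_rao_carrier[OF Z Z] k that by simp
  show "data_mat Sr Wr U $$ (k, j) =
      (if j < r then Z $$ (j, k)
       else if j - r < r * r then Z $$ ((j - r) div r, k) * Z $$ ((j - r) mod r, k)
       else if j - r - r * r < m then U $$ (j - r - r * r, k) else 1)"
  proof (cases "j < r")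
    case True
    then show ?thesis using n1 Z k by simp
  next
    case outer: False
    show ?thesis
    proof (cases "j - r < r * r")
      case True
      then show ?thesis using n1 n2[OF outer] ZZ[OF True] by (simp only: outer True if_True if_False)
    next
      case False
      moreover have "transpose_mat U $$ (k, j - r - r * r) = U $$ (j - r - r * r, k)"
        if "j - r - r * r < m" using U k that by simp
      ultimately show ?thesis using n1 n2[OF outer] n3[OF outer False] one
        by (cases "j - r - r * r < m") (simp_all only: outer if_True if_False)
    qed
  qed
qed

text \<open>
  The blocks for the inputs and the constant cancel in the difference. In row \<open>k\<close> the linear block
  contributes the norm of the \<open>k\<close>-th column of \<open>Z' - Z\<close>, and the quadratic block at most \<open>c\<close> times
  this norm, whence the factor \<open>\<surd>(1 + c\<^sup>2)\<close>.
\<close>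

proposition data_mat_perturbation:
  fixes Sr Wr Sr' Wr' U :: "real mat"
  defines "Z \<equiv> Sr * transpose_mat Wr" and "Z' \<equiv> Sr' * transpose_mat Wr'"
  assumes Z: "Z \<in> carrier_mat r K" and Z': "Z' \<in> carrier_mat r K" and U: "U \<in> carrier_mat m K"
    and rows: "dim_row Wr = K" "dim_row Wr' = K"
    and c: "\<And>k. k < K \<Longrightarrow> vec_norm2 (col Z' k) + vec_norm2 (col Z k) \<le> c"
  shows "frobenius_norm (data_mat Sr' Wr' U - data_mat Sr Wr U)
    \<le> sqrt (1 + c\<^sup>2) * frobenius_norm (Z' - Z)"
proof -
  define E where "E = data_mat Sr' Wr' U - data_mat Sr Wr U"
  note D = data_mat_carrier_nth[OF Z[unfolded Z_def] U rows(1), folded Z_def]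
  note D' = data_mat_carrier_nth[OF Z'[unfolded Z'_def] U rows(2), folded Z'_def]
  have E: "E \<in> carrier_mat K (r + (r * r + (m + 1)))" using D(1) D'(1) by (auto simp: E_def)
  have row: "(vec_norm2 (row E k))\<^sup>2 \<le> (sqrt (1 + c\<^sup>2) * vec_norm2 (col (Z' - Z) k))\<^sup>2"
    if k: "k < K" for k
  proof -
    define z z' where "z = (\<lambda>i. Z $$ (i, k))" and "z' = (\<lambda>i. Z' $$ (i, k))"
    let ?q = "\<lambda>i. z' (i div r) * z' (i mod r) - z (i div r) * z (i mod r)"
    have norms: "vec_norm2 (col Z' k) = L2_set z' {..<r}" "vec_norm2 (col Z k) = L2_set z {..<r}"
      "vec_norm2 (col (Z' - Z) k) = L2_set (\<lambda>i. z' i - z i) {..<r}"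
      unfolding vec_norm2_conv_L2_set z_def z'_def using Z Z' k by (auto intro!: L2_set_cong)
    have nth: "E $$ (k, j) = (if j < r then z' j - z j else if j - r < r * r then ?q (j - r) else 0)"
      if "j < r + (r * r + (m + 1))" for j
      unfolding E_def z_def z'_def
      using D(1) D'(1) k that by (simp add: D(2) D'(2))
    have "(vec_norm2 (row E k))\<^sup>2 = (\<Sum>j<r + (r * r + (m + 1)). (E $$ (k, j))\<^sup>2)"
      using E k by (simp add: vec_norm2_square_sum)
    also have "\<dots> = (\<Sum>j<r + r * r. (E $$ (k, j))\<^sup>2)"
      by (intro sum.mono_neutral_right) (auto simp: nth)
    also have "\<dots> = (\<Sum>j<r. (E $$ (k, j))\<^sup>2) + (\<Sum>i<r * r. (E $$ (k, r + i))\<^sup>2)"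
      by (rule sum_lessThan_add)
    also have "\<dots> = (\<Sum>j<r. (z' j - z j)\<^sup>2) + (\<Sum>i<r * r. (?q i)\<^sup>2)"
      by (simp add: nth)
    also have "\<dots> = (vec_norm2 (col (Z' - Z) k))\<^sup>2 + (L2_set ?q {..<r * r})\<^sup>2"
      unfolding norms by (simp add: L2_set_def sum_nonneg)
    also have "(L2_set ?q {..<r * r})\<^sup>2 \<le> (vec_norm2 (col (Z' - Z) k) * c)\<^sup>2"
    proof (rule power_mono)
      show "L2_set ?q {..<r * r} \<le> vec_norm2 (col (Z' - Z) k) * c"
        using kronecker_square_perturbation[of z' r z]
          mult_left_mono[OF c[OF k], of "vec_norm2 (col (Z' - Z) k)"]
        unfolding norms by simp
    qed simp
    finally show ?thesis
      by (simp add: power_mult_distrib algebra_simps)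
  qed
  have "frobenius_norm (transpose_mat E) \<le> sqrt (1 + c\<^sup>2) * frobenius_norm (Z' - Z)"
  proof (rule frobenius_norm_le_by_cols)
    fix k assume "k < dim_col (Z' - Z)"
    then have "k < K" using Z by simp
    then show "vec_norm2 (col (transpose_mat E) k) \<le> sqrt (1 + c\<^sup>2) * vec_norm2 (col (Z' - Z) k)"
      using power2_le_imp_le[OF row] E by simp
  qed (use E Z Z' in auto)
  then show ?thesis by (simp add: E_def frobenius_norm_transpose)
qed

section \<open>Error of the streaming operator\<close>

text \<open>
  The perturbation is specified on the augmented matrices; this recovers it as the difference of
  the upper blocks.
\<close>

lemma append_rows_add_zero_cancel:
  assumes A: "A \<in> carrier_mat p q" and A': "A' \<in> carrier_mat p q" and E: "E \<in> carrier_mat p q"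
    and B: "B \<in> carrier_mat p' q"
    and eq: "A' @\<^sub>r B = (A @\<^sub>r B) + (E @\<^sub>r 0\<^sub>m p' q)"
  shows "E = A' - (A :: real mat)"
proof (rule eq_matI)
  fix i j assume "i < dim_row (A' - A)" "j < dim_col (A' - A)"
  then have ij: "i < p" "j < q" using A by auto
  have "A' $$ (i, j) = (A' @\<^sub>r B) $$ (i, j)"
    using append_rows_nth[OF A' B, of i j] ij by simp
  also have "\<dots> = (A @\<^sub>r B) $$ (i, j) + (E @\<^sub>r 0\<^sub>m p' q) $$ (i, j)"
    unfolding eq using ij carrier_append_rows[OF E zero_carrier_mat, of p']
    by (intro index_add_mat) (simp_all only: carrier_matD trans_less_add1)
  also have "\<dots> = A $$ (i, j) + E $$ (i, j)"
    using append_rows_nth[OF A B, of i j] append_rows_nth[OF E zero_carrier_mat, of i p' j] ij by simp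
  finally show "E $$ (i, j) = (A' - A) $$ (i, j)" using ij A by simp
qed (use A E in auto)

theorem theorem2:
  fixes n K m r d :: nat
    and X Xt Xdot U \<Delta> V S W Vr Sr Wr Vt St Wt Vtr Str Wtr :: "real mat"
    and Dbar Rbar Dt Rt E_D E_R Op Opt :: "real mat"
    and \<gamma> :: "nat \<Rightarrow> real"
    and \<epsilon> \<sigma>1 \<tau>w \<gamma>min \<alpha> \<beta>2 :: real
  assumes "0 < n" and "0 < K" and "0 < m"
    and "1 \<le> r" and "r \<le> min n K"
    and "d = r + r\<^sup>2 + m + 1"
    and "X \<in> carrier_mat n K" and "X \<noteq> 0\<^sub>m n K"
    and "Xt \<in> carrier_mat n K"
    and "U \<in> carrier_mat m K"
    and "\<Delta> \<in> carrier_mat K K"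
    and "Xdot = X * \<Delta>"
    and "is_svd X V S W" and "truncated_svd r V S W Vr Sr Wr"
    and "is_svd Xt Vt St Wt" and "truncated_svd r Vt St Wt Vtr Str Wtr"
    and "\<sigma>1 = S $$ (0, 0)"
    and "\<tau>w = frobenius_norm (Wr - Wtr)"
    and "spectral_norm (X - Xt) \<le> \<epsilon>"
    and "\<forall>j<d. 0 < \<gamma> j"
    and "sqrt \<gamma>min = Min ((\<lambda>j. sqrt (\<gamma> j)) ` {..<d})"
    and "Dbar = reg_data_mat d \<gamma> Sr Wr U"
    and "Rbar = reg_deriv_mat d Sr Wr \<Delta>"
    and "Dt = reg_data_mat d \<gamma> Str Wtr U"
    and "Rt = reg_deriv_mat d Str Wtr \<Delta>"
    and "E_D \<in> carrier_mat K d" and "Dt = Dbar + (E_D @\<^sub>r 0\<^sub>m d d)"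
    and "E_R \<in> carrier_mat K r" and "Rt = Rbar + (E_R @\<^sub>r 0\<^sub>m d r)"
    and "Op = pinv Dbar * Rbar"
    and "Opt = pinv Dt * Rt"
    and "\<beta>2 = sqrt (real r) * (\<sigma>1 + \<epsilon>) * sqrt (1 + (2 * \<sigma>1 + \<epsilon>)\<^sup>2)"
    and "\<alpha> = (if K \<noteq> d then sqrt 2 else 1)"
  shows "spectral_norm E_D
           \<le> \<sigma>1 * \<beta>2 / (sqrt (real r) * (\<sigma>1 + \<epsilon>)) * \<tau>w + \<beta>2 / (\<sigma>1 + \<epsilon>) * \<epsilon>
       \<and> frobenius_norm E_R
           \<le> \<sigma>1 * spectral_norm \<Delta> * \<tau>w + sqrt (real r) * spectral_norm \<Delta> * \<epsilon>
       \<and> frobenius_norm (Op - Opt)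
           \<le> \<sigma>1 * spectral_norm \<Delta> / sqrt \<gamma>min * \<tau>w * (1 + \<alpha> * \<beta>2 / sqrt \<gamma>min)
             + (\<alpha> * \<beta>2 + sqrt \<gamma>min) * sqrt (real r) * spectral_norm \<Delta> / \<gamma>min * \<epsilon>"
proof -
  note r1 = assms(4) and rd = assms(6) and X = assms(7) and Xt = assms(9)
    and U = assms(10) and \<Delta> = assms(11) and svd = assms(13) and trunc = assms(14)
    and svd' = assms(15) and trunc' = assms(16) and eps = assms(19)
  define p q p' q' where "p = dim_col V" and "q = dim_col W" and "p' = dim_col Vt" and "q' = dim_col Wt"
  have dims: "dim_col V = p" "dim_col W = q" and dims': "dim_col Vt = p'" "dim_col Wt = q'"
    by (simp_all add: p_def q_def p'_def q'_def)
  define s s' where "s = (\<lambda>i. S $$ (i, i))" and "s' = (\<lambda>i. St $$ (i, i))"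
  have rle: "r \<le> p" "r \<le> q" "r \<le> p'" "r \<le> q'"
    and Sr: "Sr = mat_diag r s" and Str: "Str = mat_diag r s'"
    and Wr: "Wr = leading_cols r W" and Wtr: "Wtr = leading_cols r Wt"
    using trunc trunc' by (simp_all add: truncated_svd_def dims dims' s_def s'_def)
  note W = is_svd_carrier(2)[OF svd X dims] and Wt = is_svd_carrier(2)[OF svd' Xt dims']
  note orth = is_svdD(2)[OF svd dims] and orth' = is_svdD(2)[OF svd' dims']
  have Wrc: "Wr \<in> carrier_mat K r" and Wtrc: "Wtr \<in> carrier_mat K r"
    unfolding Wr Wtr by (rule leading_cols_carrier[OF W] leading_cols_carrier[OF Wt])+

  have \<epsilon>0: "0 \<le> \<epsilon>" using eps spectral_norm_nonneg[of "X - Xt"] by linarith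
  have weyl: "\<bar>s i - s' i\<bar> \<le> \<epsilon>" if "i < r" for i
    using Weyl_singular_value_perturbation[OF svd svd' dims dims' X Xt, of i] that rle eps
    unfolding s_def s'_def by linarith
  have sv: "0 \<le> s i" "s i \<le> \<sigma>1" if "i < r" for i
    using is_svd_singular_values[OF svd dims, of i] that rle unfolding s_def assms(17) by auto
  have \<sigma>0: "0 \<le> \<sigma>1" using sv[of 0] r1 by linarith
  have s_abs: "\<bar>s i\<bar> \<le> \<sigma>1" if "i < r" for i using sv[OF that] by linarith
  have s'_abs: "\<bar>s' i\<bar> \<le> \<sigma>1 + \<epsilon>" if "i < r" for i using sv[OF that] weyl[OF that] by linarith

  define Z Z' where "Z = Sr * transpose_mat Wr" and "Z' = Str * transpose_mat Wtr"
  have Zc: "Z \<in> carrier_mat r K" and Z'c: "Z' \<in> carrier_mat r K"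
    unfolding Z_def Z'_def Sr Str using Wrc Wtrc
    by (simp_all add: mult_carrier_mat[OF mat_diag_dim])
  \<comment> \<open>All three bounds are multiples of this bound on the reduced data error.\<close>
  define e where "e = \<sigma>1 * \<tau>w + sqrt (real r) * \<epsilon>"
  have "frobenius_norm (Z' - Z) \<le> \<sigma>1 * frobenius_norm (Wr - Wtr) + \<epsilon> * frobenius_norm Wtr"
    unfolding Z_def Z'_def Sr Str
    by (rule reduced_data_perturbation[OF Wrc Wtrc s_abs weyl \<sigma>0 \<epsilon>0])
  also have "frobenius_norm Wtr = sqrt (real r)"
    unfolding Wtr by (rule frobenius_norm_leading_cols[OF orth' Wt rle(4)])
  finally have F: "frobenius_norm (Z' - Z) \<le> e" by (simp add: e_def assms(18) mult.commute)
  have e0: "0 \<le> e" using F frobenius_norm_nonneg[of "Z' - Z"] by linarith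

  \<comment> \<open>The columns of the exact and streaming reduced data have norms at most \<open>\<sigma>1\<close> and \<open>\<sigma>1 + \<epsilon>\<close>;
    their sum enters here, and \<open>\<beta>2\<close> is \<open>sqrt r * (\<sigma>1 + \<epsilon>) * h\<close>.\<close>
  define h where "h = sqrt (1 + (2 * \<sigma>1 + \<epsilon>)\<^sup>2)"
  define D D' where "D = data_mat Sr Wr U" and "D' = data_mat Str Wtr U"
  have d: "d = r + (r * r + (m + 1))" by (simp add: rd power2_eq_square)
  have rows: "dim_row Wr = K" "dim_row Wtr = K" using Wrc Wtrc by auto
  have Dc: "D \<in> carrier_mat K d"
    unfolding D_def d by (rule data_mat_carrier_nth(1)[OF Zc[unfolded Z_def] U rows(1)])
  have D'c: "D' \<in> carrier_mat K d"
    unfolding D'_def d by (rule data_mat_carrier_nth(1)[OF Z'c[unfolded Z'_def] U rows(2)])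
  have cols: "vec_norm2 (col Z' k) + vec_norm2 (col Z k) \<le> 2 * \<sigma>1 + \<epsilon>" if k: "k < K" for k
    using vec_norm2_col_reduced_data_le[of W q K r k s \<sigma>1, OF orth W rle(2) k s_abs \<sigma>0]
      vec_norm2_col_reduced_data_le[of Wt q' K r k s' "\<sigma>1 + \<epsilon>", OF orth' Wt rle(4) k s'_abs]
      \<sigma>0 \<epsilon>0
    unfolding Z_def Z'_def Sr Str Wr Wtr by simp
  have "frobenius_norm (D' - D) \<le> h * frobenius_norm (Z' - Z)"
    unfolding D_def D'_def Z_def Z'_def h_def
    by (rule data_mat_perturbation[OF Zc[unfolded Z_def] Z'c[unfolded Z'_def] U rows
          cols[unfolded Z_def Z'_def]])
  also have "\<dots> \<le> h * e" by (rule mult_left_mono[OF F]) (simp add: h_def)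
  finally have DD: "spectral_norm (D' - D) \<le> h * e"
    using spectral_norm_le_frobenius[of "D' - D"] by linarith

  define R R' where "R = deriv_mat Sr Wr \<Delta>" and "R' = deriv_mat Str Wtr \<Delta>"
  have R: "R = transpose_mat (Z * \<Delta>)" and R': "R' = transpose_mat (Z' * \<Delta>)"
    by (simp_all add: R_def R'_def deriv_mat_def Z_def Z'_def)
  have Rc: "R \<in> carrier_mat K r" and R'c: "R' \<in> carrier_mat K r"
    unfolding R R' using Zc Z'c \<Delta> by auto
  have "R' - R = transpose_mat ((Z' - Z) * \<Delta>)"
    unfolding R R' minus_mult_distrib_mat[OF Z'c Zc \<Delta>]
    by (rule transpose_minus[OF mult_carrier_mat[OF Z'c \<Delta>] mult_carrier_mat[OF Zc \<Delta>], symmetric])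
  then have "frobenius_norm (R' - R) \<le> spectral_norm \<Delta> * frobenius_norm (Z' - Z)"
    using frobenius_norm_mult_le_spectral[OF minus_carrier_mat[OF Zc, of Z'] \<Delta>] by simp
  also have "\<dots> \<le> spectral_norm \<Delta> * e" by (rule mult_left_mono[OF F]) simp
  finally have RR: "frobenius_norm (R' - R) \<le> spectral_norm \<Delta> * e" .
  have RR': "frobenius_norm (R - R') = frobenius_norm (R' - R)"
    by (rule frobenius_norm_minus_commute[OF Rc R'c])
  have "frobenius_norm Z' \<le> (\<sigma>1 + \<epsilon>) * frobenius_norm (transpose_mat Wtr)"
    unfolding Z'_def Str using Wtrc \<sigma>0 \<epsilon>0
    by (intro frobenius_norm_mat_diag_mult_le[of _ r K]) (auto simp: s'_abs)
  also have "\<dots> = (\<sigma>1 + \<epsilon>) * sqrt (real r)"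
    unfolding frobenius_norm_transpose Wtr frobenius_norm_leading_cols[OF orth' Wt rle(4)] ..
  finally have Z'_bound: "frobenius_norm Z' \<le> (\<sigma>1 + \<epsilon>) * sqrt (real r)" .
  have "frobenius_norm R' \<le> spectral_norm \<Delta> * frobenius_norm Z'"
    unfolding R' by (rule frobenius_norm_mult_le_spectral[OF Z'c \<Delta>])
  also have "\<dots> \<le> spectral_norm \<Delta> * ((\<sigma>1 + \<epsilon>) * sqrt (real r))"
    by (rule mult_left_mono[OF Z'_bound spectral_norm_nonneg])
  finally have R'_bound: "frobenius_norm R' \<le> spectral_norm \<Delta> * ((\<sigma>1 + \<epsilon>) * sqrt (real r))" .

  define \<Gamma> where "\<Gamma> = mat_diag d (\<lambda>j. sqrt (\<gamma> j))"
  have \<Gamma>c: "\<Gamma> \<in> carrier_mat d d" by (simp add: \<Gamma>_def)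
  have Dbar: "Dbar = D @\<^sub>r \<Gamma>" and Dt: "Dt = D' @\<^sub>r \<Gamma>"
    by (simp_all add: assms(22,24) reg_data_mat_def D_def D'_def \<Gamma>_def)
  have Rbar: "Rbar = R @\<^sub>r 0\<^sub>m d r" and Rt: "Rt = R' @\<^sub>r 0\<^sub>m d r"
    by (simp_all add: assms(23,25) reg_deriv_mat_def R_def R'_def Sr Str mat_diag_def)
  have E_D: "E_D = D' - D"
    by (rule append_rows_add_zero_cancel[OF Dc D'c assms(26) \<Gamma>c assms(27)[unfolded Dbar Dt]])
  have E_R: "E_R = R' - R"
    by (rule append_rows_add_zero_cancel[OF Rc R'c assms(28) zero_carrier_mat
          assms(29)[unfolded Rbar Rt]])

  define g where "g = sqrt \<gamma>min"
  have g_le: "g \<le> sqrt (\<gamma> j)" if "j < d" for j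
    unfolding g_def assms(21) using that by (intro Min_le) auto
  have "g \<in> (\<lambda>j. sqrt (\<gamma> j)) ` {..<d}"
    unfolding g_def assms(21) by (intro Min_in) (auto simp: d)
  then have g0: "0 < g" using assms(20) by auto
  then have \<gamma>0: "0 < \<gamma>min" by (simp add: g_def)
  have gg: "\<gamma>min = g * g" using \<gamma>0 by (simp add: g_def)
  have \<gamma>_le: "\<gamma>min \<le> \<gamma> j" if "j < d" for j using g_le[OF that] by (simp add: g_def)
  have arith: "t * (\<sigma>1 * \<tau>w + q * \<epsilon>) / g + b / (g * g) * (t * (\<sigma>1 * \<tau>w + q * \<epsilon>))
      = \<sigma>1 * t / g * \<tau>w * (1 + b / g) + (b + g) * q * t / (g * g) * \<epsilon>" for t q b
    using g0 by (simp add: field_simps)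
  have "frobenius_norm (Op - Opt)
      \<le> 1 / g * frobenius_norm (R - R') + spectral_norm (D' - D) / \<gamma>min * frobenius_norm R'"
    unfolding assms(30,31) Dbar Dt Rbar Rt \<Gamma>_def g_def
    by (rule ridge_operator_perturbation[of D K d D' R r R' \<gamma>min \<gamma>, OF Dc D'c Rc R'c \<gamma>_le \<gamma>0])
  also have "\<dots> \<le> 1 / g * (spectral_norm \<Delta> * e)
      + h * e / \<gamma>min * (spectral_norm \<Delta> * ((\<sigma>1 + \<epsilon>) * sqrt (real r)))"
  proof (rule add_mono)
    show "1 / g * frobenius_norm (R - R') \<le> 1 / g * (spectral_norm \<Delta> * e)"
      unfolding RR' using g0 by (intro mult_left_mono[OF RR]) simp
    show "spectral_norm (D' - D) / \<gamma>min * frobenius_norm R'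
        \<le> h * e / \<gamma>min * (spectral_norm \<Delta> * ((\<sigma>1 + \<epsilon>) * sqrt (real r)))"
      by (rule mult_mono[OF divide_right_mono[OF DD] R'_bound])
        (use \<gamma>0 e0 in \<open>simp_all add: h_def\<close>)
  qed
  also have "\<dots> = spectral_norm \<Delta> * e / g + \<beta>2 / \<gamma>min * (spectral_norm \<Delta> * e)"
    unfolding assms(32) h_def[symmetric] by (simp add: mult_ac)
  also have "\<dots> \<le> spectral_norm \<Delta> * e / g + \<alpha> * \<beta>2 / \<gamma>min * (spectral_norm \<Delta> * e)"
  proof -
    have "0 \<le> \<beta>2" using \<sigma>0 \<epsilon>0 by (simp add: assms(32))
    moreover have "1 \<le> \<alpha>" by (simp add: assms(33))
    ultimately have "1 * \<beta>2 \<le> \<alpha> * \<beta>2" by (rule mult_right_mono[rotated])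
    then have "\<beta>2 \<le> \<alpha> * \<beta>2" by simp
    then have "\<beta>2 / \<gamma>min \<le> \<alpha> * \<beta>2 / \<gamma>min" using \<gamma>0 by (intro divide_right_mono) simp_all
    then show ?thesis using e0 by (intro add_left_mono mult_right_mono mult_nonneg_nonneg) simp_all
  qed
  also have "\<dots> = \<sigma>1 * spectral_norm \<Delta> / sqrt \<gamma>min * \<tau>w * (1 + \<alpha> * \<beta>2 / sqrt \<gamma>min)
      + (\<alpha> * \<beta>2 + sqrt \<gamma>min) * sqrt (real r) * spectral_norm \<Delta> / \<gamma>min * \<epsilon>"
    unfolding g_def[symmetric] unfolding e_def gg by (rule arith)
  finally have part3: "frobenius_norm (Op - Opt) \<le> \<dots>" .

  have part1: "spectral_norm E_D
      \<le> \<sigma>1 * \<beta>2 / (sqrt (real r) * (\<sigma>1 + \<epsilon>)) * \<tau>w + \<beta>2 / (\<sigma>1 + \<epsilon>) * \<epsilon>"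
  proof (cases "\<sigma>1 + \<epsilon> = 0")
    case True
    \<comment> \<open>Both quotients are then divisions by zero with value 0, which agrees with \<open>e = 0\<close>.\<close>
    then have "\<sigma>1 = 0" "\<epsilon> = 0" using \<sigma>0 \<epsilon>0 by auto
    then show ?thesis using DD by (simp add: E_D e_def)
  next
    case False
    have "sqrt (real r) \<noteq> 0" using r1 by simp
    then have "\<sigma>1 * \<beta>2 / (sqrt (real r) * (\<sigma>1 + \<epsilon>)) = \<sigma>1 * h"
      and "\<beta>2 / (\<sigma>1 + \<epsilon>) = sqrt (real r) * h"
      unfolding assms(32) h_def[symmetric] using False by simp_all
    then have "\<sigma>1 * \<beta>2 / (sqrt (real r) * (\<sigma>1 + \<epsilon>)) * \<tau>w + \<beta>2 / (\<sigma>1 + \<epsilon>) * \<epsilon> = h * e"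
      by (simp only:) (simp add: e_def algebra_simps)
    then show ?thesis using DD by (simp add: E_D)
  qed
  have part2: "frobenius_norm E_R
      \<le> \<sigma>1 * spectral_norm \<Delta> * \<tau>w + sqrt (real r) * spectral_norm \<Delta> * \<epsilon>"
    using RR by (simp add: E_R e_def algebra_simps)
  show ?thesis using part1 part2 part3 by blast
qed

end
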